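(* Fix $x\in(0,+\infty)$ and let $\beta=\beta(d)\ge -1$ be any sequence of real numbers (indexed by integers $d\ge 2$). Let $n=n(d)$ be a sequence of natural numbers of the form $$n=\Bigl(\frac{d}{2x+o(1)}\Bigr)^{d/2+\beta},$$ where $o(1)$ denotes a real sequence converging to $0$ as $d\to\infty$. Then $$\lim_{d\to\infty}\frac{\mathbf{E}\,\mathrm{vol}_d(P_{n,d}^{\beta})}{\mathrm{vol}_d(\mathbb{B}^d)}=e^{-x}.$$
   Context: For an integer $d\ge 2$, $\mathbb{B}^d$ is the closed Euclidean unit ball in $\mathbb{R}^d$, $\mathbb{S}^{d-1}$ its boundary, $\|\cdot\|$ the Euclidean norm and $\mathrm{vol}_d$ the Lebesgue measure on $\mathbb{R}^d$. The beta distribution on $\mathbb{R}^d$ with parameter $\beta>-1$ is the probability measure with density $$x\mapsto\frac{\Gamma(\frac d2+\beta+1)}{\pi^{d/2}\,\Gamma(\beta+1)}(1-\|x\|^2)^{\beta}\quad\text{for }\|x\|<1,$$ and $0$ elsewhere; the beta distribution with parameter $\beta=-1$ is the uniform distribution on $\mathbb{S}^{d-1}$. The beta polytope $P_{n,d}^{\beta}$ is the convex hull of $n$ i.i.d. random points $X_1,\dots,X_n$ in $\mathbb{R}^d$ with the beta distribution of parameter $\beta$. $\mathbf{E}$ denotes expectation. The parameter $\beta$ may depend on $d$. *)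

theory Defs
  imports "HOL-Probability.Probability"
begin

text \<open>
  Since the dimension \<open>d\<close> tends to infinity within a single statement, \<open>\<real>\<^sup>d\<close> cannot be
  a type. It is modelled as the set \<open>{..<d} \<rightarrow>\<^sub>E UNIV\<close> of functions \<open>nat \<Rightarrow> real\<close> (with value
  \<open>undefined\<close> at indices \<open>\<ge> d\<close>), which is the underlying space of the \<open>d\<close>-fold product of
  the Lebesgue measure on the line.
\<close>

definition lborel_dim :: "nat \<Rightarrow> (nat \<Rightarrow> real) measure" where
  "lborel_dim d = (\<Pi>\<^sub>M i\<in>{..<d}. lborel)"

abbreviation vol :: "nat \<Rightarrow> (nat \<Rightarrow> real) set \<Rightarrow> real" where
  "vol d A \<equiv> measure (lborel_dim d) A"

abbreviation norm_dim :: "nat \<Rightarrow> (nat \<Rightarrow> real) \<Rightarrow> real" where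
  "norm_dim d x \<equiv> L2_set x {..<d}"

definition unit_ball :: "nat \<Rightarrow> (nat \<Rightarrow> real) set" where
  "unit_ball d = {x \<in> {..<d} \<rightarrow>\<^sub>E UNIV. norm_dim d x \<le> 1}"

text \<open>Convexity as in \<^const>\<open>convex\<close>, with the coordinatewise vector space structure of \<open>\<real>\<^sup>d\<close>.\<close>

definition convex_dim :: "nat \<Rightarrow> (nat \<Rightarrow> real) set \<Rightarrow> bool" where
  "convex_dim d S \<longleftrightarrow> S \<subseteq> ({..<d} \<rightarrow>\<^sub>E UNIV) \<and>
     (\<forall>x\<in>S. \<forall>y\<in>S. \<forall>u\<ge>0. \<forall>v\<ge>0. u + v = 1 \<longrightarrow> (\<lambda>i\<in>{..<d}. u * x i + v * y i) \<in> S)"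

text \<open>
  The uniform distribution on the unit sphere, i.e. the normalised surface measure, given in
  polar coordinates: it assigns to \<open>A\<close> the proportion of the volume of the unit ball taken up by
  the cone over \<open>A\<close>. Equivalently, it is the distribution of \<open>x / \<parallel>x\<parallel>\<close> for \<open>x\<close> uniform in the
  ball; the null set \<open>x = 0\<close>, where the quotient is the zero vector, does not matter.
\<close>

definition uniform_sphere :: "nat \<Rightarrow> (nat \<Rightarrow> real) measure" where
  "uniform_sphere d =
     distr (uniform_measure (lborel_dim d) (unit_ball d)) (lborel_dim d)
       (\<lambda>x. \<lambda>i\<in>{..<d}. x i / norm_dim d x)"

definition beta_density :: "nat \<Rightarrow> real \<Rightarrow> (nat \<Rightarrow> real) \<Rightarrow> real" where
  "beta_density d \<beta> x =
     (if norm_dim d x < 1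
      then Gamma (real d / 2 + \<beta> + 1) / (pi powr (real d / 2) * Gamma (\<beta> + 1))
             * (1 - (norm_dim d x)\<^sup>2) powr \<beta>
      else 0)"

text \<open>Only meaningful for \<open>\<beta> \<ge> -1\<close>.\<close>

definition beta_distribution :: "nat \<Rightarrow> real \<Rightarrow> (nat \<Rightarrow> real) measure" where
  "beta_distribution d \<beta> =
     (if \<beta> = -1 then uniform_sphere d
      else density (lborel_dim d) (\<lambda>x. ennreal (beta_density d \<beta> x)))"

end

theory Submission
  imports Defs "HOL-Real_Asymp.Real_Asymp"
begin

text \<open>
  Dividing the expected volume by the volume of the ball gives the probability that a uniform point \<open>Y\<close>
  of the ball lies in the polytope; \<open>\<parallel>Y\<parallel> \<le> 1 - s / d\<close> has probability \<open>(1 - s / d) ^ d \<longlonglongrightarrow> e ^ (-s)\<close>.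
  So it suffices that the polytope essentially misses \<open>\<parallel>y\<parallel> > 1 - s / d\<close> for \<open>s < x\<close> and contains the
  ball of radius \<open>1 - s / d\<close> for \<open>s > x\<close>. Both follow from the beta measure \<open>q\<close> of a cap
  \<open>{y. \<langle>u, y\<rangle> \<ge> r}\<close>, which is \<open>(1 - r\<^sup>2) ^ (d / 2 + \<beta>)\<close> up to factors that do not matter: with
  \<open>1 - r\<^sup>2 \<approx> 2 s / d\<close>, the product \<open>n q \<approx> (s / x) ^ (d / 2 + \<beta>)\<close> is exponentially small or large.
  In the first case a point of the polytope forces a sample point into the cap it spans; in the second
  case a union bound over a grid of \<open>e ^ O(d\<^sup>3)\<close> directions shows that every direction sees a
  sample point.

  The cap estimates avoid rotation invariance. For \<open>\<beta> \<ge> 0\<close> the similarity \<open>y = r u + \<surd>(1 - r\<^sup>2) z\<close> maps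
  the half space \<open>\<langle>u, z\<rangle> \<ge> 0\<close> onto the cap and satisfies \<open>1 - \<parallel>y\<parallel>\<^sup>2 \<le> (1 - r\<^sup>2) (1 - \<parallel>z\<parallel>\<^sup>2)\<close>, with near
  equality on a thin slab. For \<open>\<beta> < 0\<close> one compares with the uniform distribution on the ball through
  cones, which are independent of the norm.
\<close>

section \<open>Euclidean geometry and Lebesgue measure on coordinate functions\<close>

text \<open>The sequence \<beta> is arbitrary, so every estimate must be uniform in it. The split at
  \<beta> = 0 is where t \<mapsto> t powr \<beta> changes its monotonicity: the similarity compares
  densities only for \<beta> \<ge> 0, and at \<beta> = -1 there is no density at all. Since \<beta>
  \<ge> -1, using the exponent d / 2 for negative \<beta> costs at most one power of the base of n,
  a polynomial loss against an exponential gain. All radii have the form 1 - s / d, and a small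
  change of s absorbs such losses. The crude grid is affordable because a direction is missed with
  probability at most exp (- n q), where n q itself grows exponentially. The normalising constants
  of the beta densities are never evaluated: the sample points have these laws, hence they are
  probability measures, and the cap bounds use only that the total mass is one. The volume of the
  hull is a random variable because membership in the hull amounts to countably many conditions, one
  for each rational direction, that are jointly measurable in the sample and the point.\<close>

definition inner_dim :: "nat \<Rightarrow> (nat \<Rightarrow> real) \<Rightarrow> (nat \<Rightarrow> real) \<Rightarrow> real" where
  "inner_dim d x y = (\<Sum>i<d. x i * y i)"

definition affine_dim :: "nat \<Rightarrow> (nat \<Rightarrow> real) \<Rightarrow> real \<Rightarrow> (nat \<Rightarrow> real) \<Rightarrow> (nat \<Rightarrow> real)" where
  "affine_dim d a c z = (\<lambda>i\<in>{..<d}. a i + c * z i)"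

lemma norm_dim_power2: "(norm_dim d x)\<^sup>2 = inner_dim d x x"
  by (simp add: L2_set_def inner_dim_def sum_nonneg power2_eq_square)

lemma inner_dim_commute: "inner_dim d x y = inner_dim d y x"
  by (simp add: inner_dim_def mult.commute)

lemma inner_dim_affine_right:
  "inner_dim d u (affine_dim d a c z) = inner_dim d u a + c * inner_dim d u z"
  by (simp add: inner_dim_def affine_dim_def algebra_simps sum.distrib sum_distrib_left)

lemma norm_dim_affine_power2:
  "(norm_dim d (affine_dim d a c z))\<^sup>2
     = (norm_dim d a)\<^sup>2 + 2 * c * inner_dim d a z + c\<^sup>2 * (norm_dim d z)\<^sup>2"
  unfolding norm_dim_power2
  by (simp add: inner_dim_def affine_dim_def algebra_simps sum.distrib
      sum_distrib_left power2_eq_square)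

lemma inner_dim_le_norm: "inner_dim d x y \<le> norm_dim d x * norm_dim d y"
proof -
  have "inner_dim d x y \<le> (\<Sum>i<d. \<bar>x i\<bar> * \<bar>y i\<bar>)"
    unfolding inner_dim_def by (intro sum_mono) (metis abs_ge_self abs_mult)
  then show ?thesis using L2_set_mult_ineq[of x y "{..<d}"] by linarith
qed

lemma norm_dim_scale: "norm_dim d (\<lambda>i\<in>{..<d}. c * z i) = \<bar>c\<bar> * norm_dim d z"
proof -
  have "norm_dim d (\<lambda>i\<in>{..<d}. c * z i) = L2_set (\<lambda>i. \<bar>c\<bar> * \<bar>z i\<bar>) {..<d}"
    unfolding L2_set_def by (simp add: power_mult_distrib)
  also have "\<dots> = \<bar>c\<bar> * L2_set (\<lambda>i. \<bar>z i\<bar>) {..<d}"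
    by (subst L2_set_right_distrib) auto
  finally show ?thesis by (simp add: L2_set_def)
qed

lemma inner_dim_scale_right: "inner_dim d u (\<lambda>i\<in>{..<d}. c * z i) = c * inner_dim d u z"
  by (simp add: inner_dim_def sum_distrib_left algebra_simps)

lemma abs_coordinate_le_norm:
  assumes "i < d"
  shows "\<bar>x i\<bar> \<le> norm_dim d x"
proof -
  have "\<bar>x i\<bar> \<le> L2_set (\<lambda>i. \<bar>x i\<bar>) {..<d}"
    using assms by (intro member_le_L2_set[where f = "\<lambda>i. \<bar>x i\<bar>"]) auto
  then show ?thesis by (simp add: L2_set_def)
qed

lemma norm_dim_divide:
  assumes "c > 0"
  shows "norm_dim d (\<lambda>i\<in>{..<d}. z i / c) = norm_dim d z / c"
  using norm_dim_scale[of "1 / c" z d] assms by simp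

section \<open>Measurability and affine changes of variables\<close>

lemma space_lborel_dim: "space (lborel_dim d) = {..<d} \<rightarrow>\<^sub>E UNIV"
  by (simp add: lborel_dim_def space_PiM)

lemma sets_lborel_dim:
  "sets (lborel_dim d) = sets (\<Pi>\<^sub>M i\<in>{..<d}. borel)"
  unfolding lborel_dim_def by (rule sets_PiM_cong) auto

lemma measurable_coordinate:
  "i < d \<Longrightarrow> (\<lambda>x. x i) \<in> borel_measurable (lborel_dim d)"
  by (subst measurable_cong_sets[OF sets_lborel_dim refl]) simp

lemma measurable_inner_dim [measurable]: "inner_dim d u \<in> borel_measurable (lborel_dim d)"
  unfolding inner_dim_def[abs_def]
  by (intro borel_measurable_sum borel_measurable_times borel_measurable_const measurable_coordinate) auto

lemma measurable_norm_dim [measurable]: "norm_dim d \<in> borel_measurable (lborel_dim d)"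
proof -
  note [measurable] = measurable_coordinate
  show ?thesis unfolding L2_set_def by measurable
qed

lemma measurable_affine_dim [measurable]:
  "affine_dim d a c \<in> lborel_dim d \<rightarrow>\<^sub>M lborel_dim d"
proof -
  have "affine_dim d a c \<in> lborel_dim d \<rightarrow>\<^sub>M (\<Pi>\<^sub>M i\<in>{..<d}. borel)"
    unfolding affine_dim_def
    by (intro measurable_restrict borel_measurable_add borel_measurable_times borel_measurable_const
        measurable_coordinate) auto
  then show ?thesis by (simp add: measurable_cong_sets[OF refl sets_lborel_dim])
qed

interpretation lborel_product: product_sigma_finite "\<lambda>_::nat. lborel :: real measure"
  by standard

lemma emeasure_lborel_dim_PiE:
  "(\<And>i. i < d \<Longrightarrow> A i \<in> sets borel) \<Longrightarrow>
    emeasure (lborel_dim d) (\<Pi>\<^sub>E i\<in>{..<d}. A i) = (\<Prod>i<d. emeasure lborel (A i))"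
  unfolding lborel_dim_def by (subst lborel_product.emeasure_PiM) auto

lemma sigma_finite_lborel_dim: "sigma_finite_measure (lborel_dim d)"
  unfolding lborel_dim_def by (rule lborel_product.sigma_finite) simp

text \<open>A product measure is determined by its values on boxes, and there the claim factors into
  the one-dimensional affine law, one factor \<open>\<bar>c\<bar>\<close> per coordinate.\<close>

lemma lborel_dim_affine:
  assumes "c \<noteq> 0"
  shows "lborel_dim d
    = density (distr (lborel_dim d) (lborel_dim d) (affine_dim d a c)) (\<lambda>_. ennreal (\<bar>c\<bar> ^ d))"
    (is "_ = ?N")
proof -
  have "?N = (\<Pi>\<^sub>M i\<in>{..<d}. lborel)"
  proof (rule lborel_product.PiM_eqI)
    show "sets ?N = sets (\<Pi>\<^sub>M i\<in>{..<d}. lborel)" by (simp add: lborel_dim_def)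
    fix A :: "nat \<Rightarrow> real set" assume "\<And>i. i \<in> {..<d} \<Longrightarrow> A i \<in> sets lborel"
    then have A: "\<And>i. i < d \<Longrightarrow> A i \<in> sets borel" by auto
    define T where "T i x = a i + c * x" for i x
    have pre: "affine_dim d a c -` (\<Pi>\<^sub>E i\<in>{..<d}. A i) \<inter> space (lborel_dim d)
       = (\<Pi>\<^sub>E i\<in>{..<d}. T i -` A i)"
      by (auto simp: space_lborel_dim affine_dim_def T_def PiE_def Pi_def)
    have S: "(\<Pi>\<^sub>E i\<in>{..<d}. A i) \<in> sets (lborel_dim d)"
      unfolding sets_lborel_dim by (rule sets_PiM_I_finite) (auto simp: A)
    have T: "T i \<in> borel_measurable borel" for i unfolding T_def by measurable
    have TA: "T i -` A i \<in> sets borel" if "i < d" for i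
      using measurable_sets[OF T A[OF that], of i] by simp
    have "emeasure ?N (\<Pi>\<^sub>E i\<in>{..<d}. A i)
       = ennreal (\<bar>c\<bar> ^ d) * emeasure (lborel_dim d) (\<Pi>\<^sub>E i\<in>{..<d}. T i -` A i)"
      using S by (simp add: emeasure_density nn_integral_cmult_indicator emeasure_distr pre)
    also have "\<dots> = ennreal (\<bar>c\<bar> ^ d) * (\<Prod>i<d. emeasure lborel (T i -` A i))"
      using TA by (subst emeasure_lborel_dim_PiE) auto
    also have "\<dots> = (\<Prod>i<d. ennreal \<bar>c\<bar> * emeasure lborel (T i -` A i))"
      by (simp add: prod.distrib ennreal_power)
    also have "\<dots> = (\<Prod>i<d. emeasure lborel (A i))"
    proof (rule prod.cong[OF refl])
      fix i assume "i \<in> {..<d}" then have i: "i < d" by simp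
      have "emeasure lborel (A i) = ennreal \<bar>c\<bar> * emeasure (distr lborel borel (T i)) (A i)"
        using A[OF i] unfolding T_def
        by (subst lborel_real_affine[OF assms, of "a i"])
          (simp add: emeasure_density nn_integral_cmult_indicator)
      then show "ennreal \<bar>c\<bar> * emeasure lborel (T i -` A i) = emeasure lborel (A i)"
        using A[OF i] T by (simp add: emeasure_distr)
    qed
    finally show "emeasure ?N (\<Pi>\<^sub>E i\<in>{..<d}. A i) = (\<Prod>i\<in>{..<d}. emeasure lborel (A i))" .
  qed simp
  then show ?thesis by (simp add: lborel_dim_def)
qed

lemma nn_integral_lborel_dim_affine:
  assumes "c \<noteq> 0" and [measurable]: "f \<in> borel_measurable (lborel_dim d)"
  shows "(\<integral>\<^sup>+x. f x \<partial>lborel_dim d)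
    = ennreal (\<bar>c\<bar> ^ d) * (\<integral>\<^sup>+z. f (affine_dim d a c z) \<partial>lborel_dim d)"
  by (subst lborel_dim_affine[OF assms(1), of _ a])
    (simp add: nn_integral_density nn_integral_distr nn_integral_cmult)

section \<open>Balls and scaling of volume\<close>

definition ball_dim :: "nat \<Rightarrow> real \<Rightarrow> (nat \<Rightarrow> real) set" where
  "ball_dim d r = {y \<in> space (lborel_dim d). norm_dim d y \<le> r}"

lemma ball_dim_sets [measurable]: "ball_dim d r \<in> sets (lborel_dim d)"
  unfolding ball_dim_def by measurable

lemma unit_ball_eq: "unit_ball d = ball_dim d 1"
  by (simp add: unit_ball_def ball_dim_def space_lborel_dim)

lemma unit_ball_sets [measurable]: "unit_ball d \<in> sets (lborel_dim d)"
  by (simp add: unit_ball_eq)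

text \<open>\<open>B\<close> is described by membership of the rescaled point, so that for balls and
  cones the side condition is a pointwise equivalence; as a preimage of \<open>A\<close> it is
  measurable.\<close>

lemma emeasure_scale_dim:
  assumes "c > 0" and [measurable]: "A \<in> sets (lborel_dim d)"
    and B: "B = {y \<in> space (lborel_dim d). (\<lambda>i\<in>{..<d}. y i / c) \<in> A}"
  shows "emeasure (lborel_dim d) B = ennreal (c ^ d) * emeasure (lborel_dim d) A"
proof -
  have eq: "affine_dim d (\<lambda>_. 0) (1/c) = (\<lambda>y. \<lambda>i\<in>{..<d}. y i / c)"
    by (simp add: affine_dim_def fun_eq_iff)
  have "emeasure (lborel_dim d) A
     = ennreal ((1/c) ^ d) * (\<integral>\<^sup>+z. indicator A (affine_dim d (\<lambda>_. 0) (1/c) z) \<partial>lborel_dim d)"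
    using nn_integral_lborel_dim_affine[of "1/c" "indicator A" d "\<lambda>_. 0"] assms(1) by simp
  also have "(\<integral>\<^sup>+z. indicator A (affine_dim d (\<lambda>_. 0) (1/c) z) \<partial>lborel_dim d)
     = (\<integral>\<^sup>+z. indicator B z \<partial>lborel_dim d)"
    by (intro nn_integral_cong) (auto simp: B eq indicator_def)
  also have "\<dots> = emeasure (lborel_dim d) B"
  proof -
    have "B = affine_dim d (\<lambda>_. 0) (1/c) -` A \<inter> space (lborel_dim d)" by (auto simp: B eq)
    then have "B \<in> sets (lborel_dim d)" by simp
    then show ?thesis by simp
  qed
  finally have "ennreal (c ^ d) * emeasure (lborel_dim d) A
     = (ennreal (c ^ d) * ennreal ((1/c) ^ d)) * emeasure (lborel_dim d) B"
    by (simp add: mult.assoc)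
  also have "ennreal (c ^ d) * ennreal ((1/c) ^ d) = 1"
    using assms(1) by (subst ennreal_mult[symmetric]) (auto simp: power_divide)
  finally show ?thesis by simp
qed

lemma emeasure_unit_ball_finite: "emeasure (lborel_dim d) (unit_ball d) < \<infinity>"
proof -
  have "unit_ball d \<subseteq> (\<Pi>\<^sub>E i\<in>{..<d}. {-1..1})"
  proof
    fix x assume x: "x \<in> unit_ball d"
    have "\<bar>x i\<bar> \<le> 1" if "i < d" for i
      using abs_coordinate_le_norm[OF that, of x] x by (simp add: unit_ball_def)
    then show "x \<in> (\<Pi>\<^sub>E i\<in>{..<d}. {-1..1})"
      using x by (auto simp: unit_ball_def PiE_def Pi_def abs_le_iff minus_le_iff)
  qed
  moreover have "(\<Pi>\<^sub>E i\<in>{..<d}. {-1..1::real}) \<in> sets (lborel_dim d)"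
    unfolding sets_lborel_dim by (rule sets_PiM_I_finite) auto
  ultimately have "emeasure (lborel_dim d) (unit_ball d)
     \<le> emeasure (lborel_dim d) (\<Pi>\<^sub>E i\<in>{..<d}. {-1..1})"
    by (rule emeasure_mono)
  also have "\<dots> = (\<Prod>i<d. emeasure lborel {-1..1::real})"
    by (rule emeasure_lborel_dim_PiE) auto
  also have "\<dots> < \<infinity>" by (simp add: power_less_top_ennreal)
  finally show ?thesis .
qed

lemma emeasure_unit_ball_pos: "0 < emeasure (lborel_dim d) (unit_ball d)"
proof (cases "d = 0")
  case True
  then have "unit_ball d = {\<lambda>_. undefined}" by (auto simp: unit_ball_def)
  then show ?thesis using True by (simp add: lborel_dim_def)
next
  case False
  \<comment> \<open>Side length 1 / d makes the sum of the coordinates at most 1, and this sum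
    dominates the Euclidean norm.\<close>
  have "(\<Pi>\<^sub>E i\<in>{..<d}. {0..1 / real d}) \<subseteq> unit_ball d"
  proof
    fix x assume x: "x \<in> (\<Pi>\<^sub>E i\<in>{..<d}. {0..1 / real d})"
    have "norm_dim d x \<le> (\<Sum>i<d. \<bar>x i\<bar>)" by (rule L2_set_le_sum_abs)
    also have "\<dots> \<le> (\<Sum>i<d. 1 / real d)" using x by (intro sum_mono) (auto simp: PiE_def Pi_def)
    also have "\<dots> = 1" using False by simp
    finally show "x \<in> unit_ball d" using x by (auto simp: unit_ball_def PiE_def)
  qed
  then have "emeasure (lborel_dim d) (\<Pi>\<^sub>E i\<in>{..<d}. {0..1 / real d})
      \<le> emeasure (lborel_dim d) (unit_ball d)"
    by (intro emeasure_mono) auto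
  moreover have "emeasure (lborel_dim d) (\<Pi>\<^sub>E i\<in>{..<d}. {0..1 / real d})
     = (\<Prod>i<d. emeasure lborel {0..1 / real d})"
    by (rule emeasure_lborel_dim_PiE) auto
  moreover have "0 < (\<Prod>i<d. emeasure lborel {0..1 / real d})"
    using False by (auto simp: ennreal_power)
  ultimately show ?thesis by (metis order_less_le_trans)
qed

lemma vol_unit_ball_pos: "0 < vol d (unit_ball d)"
  using emeasure_unit_ball_finite emeasure_unit_ball_pos
  by (simp add: measure_def enn2real_positive_iff)

lemma emeasure_unit_ball: "emeasure (lborel_dim d) (unit_ball d) = ennreal (vol d (unit_ball d))"
  using emeasure_unit_ball_finite[of d] by (simp add: emeasure_eq_ennreal_measure less_top)

lemma emeasure_ball_dim:
  assumes "0 < r"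
  shows "emeasure (lborel_dim d) (ball_dim d r) = ennreal (r ^ d * vol d (unit_ball d))"
proof -
  have "norm_dim d (\<lambda>i\<in>{..<d}. y i / r) \<le> 1 \<longleftrightarrow> norm_dim d y \<le> r" for y :: "nat \<Rightarrow> real"
    using assms by (simp add: norm_dim_divide divide_le_eq)
  then have "emeasure (lborel_dim d) (ball_dim d r)
      = ennreal (r ^ d) * emeasure (lborel_dim d) (unit_ball d)"
    using assms by (intro emeasure_scale_dim unit_ball_sets) (auto simp: ball_dim_def unit_ball_def space_lborel_dim)
  then show ?thesis using assms by (simp add: emeasure_unit_ball ennreal_mult)
qed

section \<open>Cap estimates for nonnegative exponents\<close>

text \<open>The beta density without its normalising constant. The estimates compare the mass of a
  set with the total mass, so the constant cancels.\<close>

definition beta_profile :: "nat \<Rightarrow> real \<Rightarrow> (nat \<Rightarrow> real) \<Rightarrow> real" where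
  "beta_profile d \<beta> x = (if norm_dim d x < 1 then (1 - (norm_dim d x)\<^sup>2) powr \<beta> else 0)"

definition beta_mass :: "nat \<Rightarrow> real \<Rightarrow> (nat \<Rightarrow> real) measure" where
  "beta_mass d \<beta> = density (lborel_dim d) (\<lambda>x. ennreal (beta_profile d \<beta> x))"

definition cap :: "nat \<Rightarrow> (nat \<Rightarrow> real) \<Rightarrow> real \<Rightarrow> (nat \<Rightarrow> real) set" where
  "cap d u r = {y \<in> space (lborel_dim d). r \<le> inner_dim d u y}"

lemma cap_sets [measurable]: "cap d u r \<in> sets (lborel_dim d)"
  unfolding cap_def by measurable

lemma beta_profile_nonneg: "0 \<le> beta_profile d \<beta> x"
  by (simp add: beta_profile_def)

lemma measurable_beta_profile [measurable]: "beta_profile d \<beta> \<in> borel_measurable (lborel_dim d)"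
  unfolding beta_profile_def by measurable

lemma sets_beta_mass [measurable_cong, simp]: "sets (beta_mass d \<beta>) = sets (lborel_dim d)"
  by (simp add: beta_mass_def)

lemma space_beta_mass [simp]: "space (beta_mass d \<beta>) = space (lborel_dim d)"
  by (simp add: beta_mass_def)

lemma emeasure_beta_mass:
  "A \<in> sets (lborel_dim d) \<Longrightarrow>
    emeasure (beta_mass d \<beta>) A = (\<integral>\<^sup>+x. ennreal (beta_profile d \<beta> x) * indicator A x \<partial>lborel_dim d)"
  by (simp add: beta_mass_def emeasure_density)

lemma norm_dim_less_one_iff: "norm_dim d x < 1 \<longleftrightarrow> 0 < 1 - (norm_dim d x)\<^sup>2"
  by (simp add: power_less_one_iff abs_square_less_1)

lemma affine_dim_space: "affine_dim d a c z \<in> space (lborel_dim d)"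
  by (simp add: affine_dim_def space_lborel_dim)

lemma emeasure_beta_mass_cap_affine:
  assumes "b > 0" "norm_dim d u = 1"
  shows "emeasure (beta_mass d \<beta>) (cap d u r) = ennreal (b ^ d) *
    (\<integral>\<^sup>+z. ennreal (beta_profile d \<beta> (affine_dim d (\<lambda>i. r * u i) b z)) * indicator (cap d u 0) z
      \<partial>lborel_dim d)"
proof -
  have uu: "inner_dim d u (\<lambda>i. r * u i) = r"
    using assms(2) norm_dim_power2[of u d]
    by (simp add: inner_dim_def algebra_simps flip: sum_distrib_left)
  have "emeasure (beta_mass d \<beta>) (cap d u r) = ennreal (\<bar>b\<bar> ^ d) *
    (\<integral>\<^sup>+z. ennreal (beta_profile d \<beta> (affine_dim d (\<lambda>i. r * u i) b z)) *
      indicator (cap d u r) (affine_dim d (\<lambda>i. r * u i) b z) \<partial>lborel_dim d)"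
    unfolding emeasure_beta_mass[OF cap_sets]
    using assms(1) by (intro nn_integral_lborel_dim_affine) auto
  also have "(\<integral>\<^sup>+z. ennreal (beta_profile d \<beta> (affine_dim d (\<lambda>i. r * u i) b z)) *
      indicator (cap d u r) (affine_dim d (\<lambda>i. r * u i) b z) \<partial>lborel_dim d)
    = (\<integral>\<^sup>+z. ennreal (beta_profile d \<beta> (affine_dim d (\<lambda>i. r * u i) b z)) * indicator (cap d u 0) z
      \<partial>lborel_dim d)"
    using assms(1)
    by (intro nn_integral_cong)
      (auto simp: indicator_def cap_def affine_dim_space inner_dim_affine_right uu zero_le_mult_iff)
  finally show ?thesis using assms(1) by simp
qed

lemma one_minus_norm_affine:
  assumes "norm_dim d u = 1"
  shows "1 - (norm_dim d (affine_dim d (\<lambda>i. r * u i) b z))\<^sup>2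
    = 1 - r\<^sup>2 - 2 * b * r * inner_dim d u z - b\<^sup>2 * (norm_dim d z)\<^sup>2"
proof -
  have "inner_dim d (\<lambda>i. r * u i) z = r * inner_dim d u z"
    by (simp add: inner_dim_def sum_distrib_left algebra_simps)
  moreover have "(norm_dim d (\<lambda>i. r * u i))\<^sup>2 = r\<^sup>2"
  proof -
    have "inner_dim d (\<lambda>i. r * u i) (\<lambda>i. r * u i) = r\<^sup>2 * inner_dim d u u"
      by (simp add: inner_dim_def sum_distrib_left algebra_simps power2_eq_square)
    then show ?thesis using assms by (simp add: norm_dim_power2[symmetric])
  qed
  ultimately show ?thesis by (simp add: norm_dim_affine_power2)
qed

text \<open>On the half space the cross term of \<open>one_minus_norm_affine\<close> has a sign and
  may be dropped. The Jacobian contributes the power d / 2, the density the power \<beta>.\<close>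

lemma beta_mass_cap_upper:
  assumes "\<beta> \<ge> 0" "0 \<le> r" "r < 1" and u: "norm_dim d u = 1"
  shows "emeasure (beta_mass d \<beta>) (cap d u r)
    \<le> ennreal ((1 - r\<^sup>2) powr (real d / 2 + \<beta>)) * emeasure (beta_mass d \<beta>) (space (lborel_dim d))"
proof -
  define b where "b = sqrt (1 - r\<^sup>2)"
  have r2: "r\<^sup>2 < 1" using assms by (simp add: power_less_one_iff abs_square_less_1)
  then have b: "b > 0" "b\<^sup>2 = 1 - r\<^sup>2" by (auto simp: b_def)
  have key: "beta_profile d \<beta> (affine_dim d (\<lambda>i. r * u i) b z) \<le> (1 - r\<^sup>2) powr \<beta> * beta_profile d \<beta> z"
    if z: "z \<in> cap d u 0" for z
  proof (cases "norm_dim d (affine_dim d (\<lambda>i. r * u i) b z) < 1")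
    case True
    let ?q = "1 - (norm_dim d (affine_dim d (\<lambda>i. r * u i) b z))\<^sup>2"
    have q: "0 < ?q" using True norm_dim_less_one_iff by blast
    have "0 \<le> 2 * b * r * inner_dim d u z" using z b assms by (simp add: cap_def)
    then have le: "?q \<le> (1 - r\<^sup>2) * (1 - (norm_dim d z)\<^sup>2)"
      unfolding one_minus_norm_affine[OF u] b(2) by (simp add: algebra_simps)
    \<comment> \<open>A positive lower end of the chain forces z into the open ball, where its
      profile is a genuine power and not the default 0.\<close>
    with q r2 have nz: "0 < 1 - (norm_dim d z)\<^sup>2"
      by (smt (verit) mult_nonneg_nonpos)
    have "?q powr \<beta> \<le> ((1 - r\<^sup>2) * (1 - (norm_dim d z)\<^sup>2)) powr \<beta>"
      using q le assms(1) by (intro powr_mono2) auto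
    also have "\<dots> = (1 - r\<^sup>2) powr \<beta> * (1 - (norm_dim d z)\<^sup>2) powr \<beta>"
      using nz r2 by (intro powr_mult)
    finally show ?thesis using True nz by (simp add: beta_profile_def norm_dim_less_one_iff)
  qed (simp add: beta_profile_def)
  have "emeasure (beta_mass d \<beta>) (cap d u r) \<le> ennreal (b ^ d) *
    (\<integral>\<^sup>+z. ennreal ((1 - r\<^sup>2) powr \<beta>) *
      (ennreal (beta_profile d \<beta> z) * indicator (space (lborel_dim d)) z) \<partial>lborel_dim d)"
    unfolding emeasure_beta_mass_cap_affine[OF b(1) u]
    by (intro mult_left_mono nn_integral_mono)
      (auto simp: indicator_def ennreal_mult[symmetric] beta_profile_nonneg intro!: ennreal_leI key)
  also have "\<dots> = ennreal (b ^ d) * (ennreal ((1 - r\<^sup>2) powr \<beta>) * emeasure (beta_mass d \<beta>) (space (lborel_dim d)))"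
    by (subst nn_integral_cmult) (auto simp: emeasure_beta_mass)
  also have "\<dots> = ennreal (b ^ d * (1 - r\<^sup>2) powr \<beta>) * emeasure (beta_mass d \<beta>) (space (lborel_dim d))"
    using b by (simp add: ennreal_mult mult.assoc)
  also have "b ^ d = (1 - r\<^sup>2) powr (real d / 2)"
    using r2 b by (simp add: b_def powr_half_sqrt[symmetric] powr_powr flip: powr_realpow)
  finally show ?thesis by (simp add: powr_add)
qed

section \<open>Thin slabs and the lower bound for caps\<close>

definition slab :: "nat \<Rightarrow> (nat \<Rightarrow> real) \<Rightarrow> real \<Rightarrow> real \<Rightarrow> (nat \<Rightarrow> real) set" where
  "slab d u s t = {y \<in> space (lborel_dim d). s \<le> inner_dim d u y \<and> inner_dim d u y \<le> t}"

lemma slab_sets [measurable]: "slab d u s t \<in> sets (lborel_dim d)"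
  unfolding slab_def by measurable

text \<open>Shifting by s u moves points with nonnegative inner product away from the origin, and
  for \<beta> \<ge> 0 the profile decreases with the norm.\<close>

lemma beta_mass_slab_le:
  assumes "\<beta> \<ge> 0" "0 \<le> s" and u: "norm_dim d u = 1"
  shows "emeasure (beta_mass d \<beta>) (slab d u s (s + \<eta>)) \<le> emeasure (beta_mass d \<beta>) (slab d u 0 \<eta>)"
proof -
  have "emeasure (beta_mass d \<beta>) (slab d u s (s + \<eta>)) = ennreal (\<bar>1\<bar> ^ d) *
    (\<integral>\<^sup>+z. ennreal (beta_profile d \<beta> (affine_dim d (\<lambda>i. s * u i) 1 z)) *
      indicator (slab d u s (s + \<eta>)) (affine_dim d (\<lambda>i. s * u i) 1 z) \<partial>lborel_dim d)"
    unfolding emeasure_beta_mass[OF slab_sets]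
    by (intro nn_integral_lborel_dim_affine) auto
  also have "\<dots> \<le> (\<integral>\<^sup>+z. ennreal (beta_profile d \<beta> z) * indicator (slab d u 0 \<eta>) z \<partial>lborel_dim d)"
  proof (simp, intro nn_integral_mono)
    fix z assume zs: "z \<in> space (lborel_dim d)"
    let ?y = "affine_dim d (\<lambda>i. s * u i) 1 z"
    have uu: "inner_dim d u (\<lambda>i. s * u i) = s"
      using u norm_dim_power2[of u d]
      by (simp add: inner_dim_def algebra_simps flip: sum_distrib_left)
    have mem: "?y \<in> slab d u s (s + \<eta>) \<longleftrightarrow> z \<in> slab d u 0 \<eta>"
      by (auto simp: slab_def inner_dim_affine_right uu affine_dim_space zs)
    have "beta_profile d \<beta> ?y \<le> beta_profile d \<beta> z" if z: "z \<in> slab d u 0 \<eta>"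
    proof (cases "norm_dim d ?y < 1")
      case True
      then have y: "0 < 1 - (norm_dim d ?y)\<^sup>2" using norm_dim_less_one_iff by blast
      have "0 \<le> 2 * s * inner_dim d u z" using z assms by (simp add: slab_def)
      then have le: "1 - (norm_dim d ?y)\<^sup>2 \<le> 1 - (norm_dim d z)\<^sup>2"
        unfolding one_minus_norm_affine[OF u] using zero_le_power2[of s]
        by (simp only: mult_1_right mult_1 power_one)
      then have "0 < 1 - (norm_dim d z)\<^sup>2" using y by linarith
      then have "norm_dim d z < 1" using norm_dim_less_one_iff by blast
      moreover have "(1 - (norm_dim d ?y)\<^sup>2) powr \<beta> \<le> (1 - (norm_dim d z)\<^sup>2) powr \<beta>"
        using y le assms(1) by (intro powr_mono2) auto
      ultimately show ?thesis using True by (simp add: beta_profile_def)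
    qed (simp add: beta_profile_def)
    then show "ennreal (beta_profile d \<beta> ?y) * indicator (slab d u s (s + \<eta>)) ?y
      \<le> ennreal (beta_profile d \<beta> z) * indicator (slab d u 0 \<eta>) z"
      by (auto simp: indicator_def mem intro!: ennreal_leI)
  qed
  finally show ?thesis by (simp add: emeasure_beta_mass)
qed

text \<open>The reflection z \<mapsto> - z preserves the profile and exchanges the two closed half
  spaces, which together cover everything.\<close>

lemma beta_mass_halfspace:
  "emeasure (beta_mass d \<beta>) (space (lborel_dim d)) \<le> 2 * emeasure (beta_mass d \<beta>) (cap d u 0)"
proof -
  let ?H = "{y \<in> space (lborel_dim d). inner_dim d u y \<le> 0}"
  have H [measurable]: "?H \<in> sets (lborel_dim d)" by measurable
  have "emeasure (beta_mass d \<beta>) ?H = ennreal (\<bar>-1\<bar> ^ d) *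
    (\<integral>\<^sup>+z. ennreal (beta_profile d \<beta> (affine_dim d (\<lambda>i. 0) (-1) z)) *
      indicator ?H (affine_dim d (\<lambda>i. 0) (-1) z) \<partial>lborel_dim d)"
    unfolding emeasure_beta_mass[OF H]
    by (intro nn_integral_lborel_dim_affine) auto
  also have "\<dots> = (\<integral>\<^sup>+z. ennreal (beta_profile d \<beta> z) * indicator (cap d u 0) z \<partial>lborel_dim d)"
  proof (simp, intro nn_integral_cong)
    fix z assume zs: "z \<in> space (lborel_dim d)"
    have "(norm_dim d (affine_dim d (\<lambda>i. 0) (-1) z))\<^sup>2 = (norm_dim d z)\<^sup>2"
      by (simp add: norm_dim_power2 inner_dim_def affine_dim_def)
    then have "norm_dim d (affine_dim d (\<lambda>i. 0) (-1) z) = norm_dim d z"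
      by simp
    moreover have "affine_dim d (\<lambda>i. 0) (-1) z \<in> ?H \<longleftrightarrow> z \<in> cap d u 0"
      using zs inner_dim_affine_right[of d u "\<lambda>_. 0" "-1" z]
      by (simp add: cap_def affine_dim_space) (simp add: inner_dim_def)
    ultimately show "ennreal (beta_profile d \<beta> (affine_dim d (\<lambda>i. 0) (-1) z)) *
        indicator ?H (affine_dim d (\<lambda>i. 0) (-1) z)
      = ennreal (beta_profile d \<beta> z) * indicator (cap d u 0) z"
      by (simp add: beta_profile_def indicator_def)
  qed
  also have "\<dots> = emeasure (beta_mass d \<beta>) (cap d u 0)" by (simp add: emeasure_beta_mass)
  finally have eq: "emeasure (beta_mass d \<beta>) ?H = emeasure (beta_mass d \<beta>) (cap d u 0)" .
  have "emeasure (beta_mass d \<beta>) (space (lborel_dim d)) = emeasure (beta_mass d \<beta>) (?H \<union> cap d u 0)"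
    by (rule arg_cong[where f = "emeasure _"]) (auto simp: cap_def)
  also have "\<dots> \<le> emeasure (beta_mass d \<beta>) ?H + emeasure (beta_mass d \<beta>) (cap d u 0)"
    by (intro emeasure_subadditive) auto
  finally show ?thesis by (simp add: eq mult_2)
qed

text \<open>
  Translating a slab towards the origin increases the density, so the innermost of the
  \<open>\<lceil>1 / \<eta>\<rceil>\<close> slabs covering half of the ball carries the largest share.
\<close>

lemma beta_mass_slab_lower:
  assumes "\<beta> \<ge> 0" "0 < \<eta>" "\<eta> \<le> 1" and u: "norm_dim d u = 1"
  shows "ennreal (\<eta> / 4) * emeasure (beta_mass d \<beta>) (space (lborel_dim d))
    \<le> emeasure (beta_mass d \<beta>) (slab d u 0 \<eta>)"
proof -
  define N where "N = nat \<lceil>1 / \<eta>\<rceil>"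
  have N: "1 / \<eta> \<le> real N" "real N \<le> 1 / \<eta> + 1"
    using assms by (auto simp: N_def)
  \<comment> \<open>At most 2 / \<eta> slabs share at least half of the mass: this is the origin of
    the factor \<eta> / 4.\<close>
  have N2: "real N \<le> 2 / \<eta>" using N(2) assms by (simp add: field_simps)
  let ?S = "\<lambda>k. slab d u (real k * \<eta>) (real k * \<eta> + \<eta>)"
  \<comment> \<open>Only the open ball has to be covered, since the profile vanishes outside
    it.\<close>
  have cover: "y \<in> (\<Union>k<N. ?S k)" if y: "y \<in> cap d u 0" "norm_dim d y < 1" for y
  proof -
    define t where "t = inner_dim d u y"
    have t: "0 \<le> t" "t < 1" using y inner_dim_le_norm[of d u y] u by (auto simp: t_def cap_def)
    define k where "k = nat \<lfloor>t / \<eta>\<rfloor>"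
    have k: "real k \<le> t / \<eta>" "t / \<eta> < real k + 1" using t assms by (auto simp: k_def)
    have "real k < real N" using k(1) N(1) t assms by (smt (verit) divide_strict_right_mono)
    moreover have "y \<in> ?S k" using k assms y by (auto simp: slab_def cap_def t_def field_simps)
    ultimately show ?thesis by auto
  qed
  have "emeasure (beta_mass d \<beta>) (cap d u 0) \<le> emeasure (beta_mass d \<beta>) (\<Union>k<N. ?S k)"
  proof -
    have "emeasure (beta_mass d \<beta>) (cap d u 0)
      \<le> (\<integral>\<^sup>+x. ennreal (beta_profile d \<beta> x) * indicator (\<Union>k<N. ?S k) x \<partial>lborel_dim d)"
      unfolding emeasure_beta_mass[OF cap_sets]
    proof (rule nn_integral_mono)
      fix x
      show "ennreal (beta_profile d \<beta> x) * indicator (cap d u 0) x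
        \<le> ennreal (beta_profile d \<beta> x) * indicator (\<Union>k<N. ?S k) x"
        using cover[of x] by (cases "norm_dim d x < 1") (auto simp: indicator_def beta_profile_def)
    qed
    then show ?thesis by (subst emeasure_beta_mass) auto
  qed
  also have "\<dots> \<le> (\<Sum>k<N. emeasure (beta_mass d \<beta>) (?S k))"
    by (rule emeasure_subadditive_finite) auto
  also have "\<dots> \<le> (\<Sum>k<N. emeasure (beta_mass d \<beta>) (slab d u 0 \<eta>))"
    using assms by (intro sum_mono beta_mass_slab_le) auto
  also have "\<dots> = ennreal (real N) * emeasure (beta_mass d \<beta>) (slab d u 0 \<eta>)"
    by (simp add: ennreal_of_nat_eq_real_of_nat)
  also have "\<dots> \<le> ennreal (2 / \<eta>) * emeasure (beta_mass d \<beta>) (slab d u 0 \<eta>)"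
    using N2 by (intro mult_right_mono ennreal_leI) auto
  finally have 1: "emeasure (beta_mass d \<beta>) (cap d u 0)
     \<le> ennreal (2 / \<eta>) * emeasure (beta_mass d \<beta>) (slab d u 0 \<eta>)" .
  have "ennreal (\<eta> / 4) * emeasure (beta_mass d \<beta>) (space (lborel_dim d))
     \<le> ennreal (\<eta> / 4) * (2 * (ennreal (2 / \<eta>) * emeasure (beta_mass d \<beta>) (slab d u 0 \<eta>)))"
    by (intro mult_left_mono order_trans[OF beta_mass_halfspace[of _ _ u]] 1) auto
  also have "\<dots> = ennreal (\<eta> / 4) * ennreal 2 * ennreal (2 / \<eta>) * emeasure (beta_mass d \<beta>) (slab d u 0 \<eta>)"
    by (simp add: mult.assoc)
  also have "ennreal (\<eta> / 4) * ennreal 2 * ennreal (2 / \<eta>) = 1"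
    using assms by (simp add: ennreal_mult[symmetric] del: ennreal_numeral)
  finally show ?thesis by simp
qed

lemma beta_mass_cap_lower:
  assumes "\<beta> \<ge> 0" "0 \<le> r" "r < 1" "0 < \<delta>" "\<delta> < 1" and u: "norm_dim d u = 1"
  defines "\<kappa> \<equiv> 1 - r\<^sup>2"
  shows "ennreal ((\<kappa> * (1 - \<delta>)) powr (real d / 2 + \<beta>) * (\<kappa> * \<delta> / 8))
      * emeasure (beta_mass d \<beta>) (space (lborel_dim d))
    \<le> emeasure (beta_mass d \<beta>) (cap d u r)"
proof -
  have r2: "r\<^sup>2 < 1" using assms by (simp add: power_less_one_iff abs_square_less_1)
  then have \<kappa>: "0 < \<kappa>" "\<kappa> \<le> 1" by (auto simp: \<kappa>_def)
  define b where "b = sqrt (\<kappa> * (1 - \<delta>))"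
  define \<eta> where "\<eta> = \<kappa> * \<delta> / 2"
  have b: "b > 0" "b\<^sup>2 = \<kappa> * (1 - \<delta>)" using \<kappa> assms by (auto simp: b_def)
  have b1: "b \<le> 1" using \<kappa> assms by (simp add: b_def mult_le_one)
  have \<eta>: "0 < \<eta>" "\<eta> \<le> 1" using \<kappa> assms mult_le_one[of \<kappa> \<delta>] by (auto simp: \<eta>_def)
  have key: "(\<kappa> * (1 - \<delta>)) powr \<beta> * beta_profile d \<beta> z \<le> beta_profile d \<beta> (affine_dim d (\<lambda>i. r * u i) b z)"
    if z: "z \<in> slab d u 0 \<eta>" for z
  proof (cases "norm_dim d z < 1")
    case True
    let ?q = "1 - (norm_dim d (affine_dim d (\<lambda>i. r * u i) b z))\<^sup>2"
    have nz: "0 < 1 - (norm_dim d z)\<^sup>2" using True norm_dim_less_one_iff by blast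
    have "(b * r) * inner_dim d u z \<le> 1 * \<eta>"
      using z b b1 assms by (intro mult_mono) (auto simp: slab_def mult_le_one)
    then have le: "\<kappa> * (1 - \<delta>) * (1 - (norm_dim d z)\<^sup>2) \<le> ?q"
      unfolding one_minus_norm_affine[OF u] b(2) \<eta>_def \<kappa>_def[symmetric]
      by (simp add: algebra_simps)
    moreover have p: "0 < \<kappa> * (1 - \<delta>) * (1 - (norm_dim d z)\<^sup>2)" using nz \<kappa> assms by simp
    ultimately have q: "0 < ?q" by linarith
    have "(\<kappa> * (1 - \<delta>)) powr \<beta> * (1 - (norm_dim d z)\<^sup>2) powr \<beta>
      = (\<kappa> * (1 - \<delta>) * (1 - (norm_dim d z)\<^sup>2)) powr \<beta>"
      using nz \<kappa> assms by (intro powr_mult[symmetric])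
    also have "\<dots> \<le> ?q powr \<beta>" using p le assms(1) by (intro powr_mono2) auto
    finally show ?thesis using q True by (simp add: beta_profile_def norm_dim_less_one_iff)
  qed (simp add: beta_profile_def)
  let ?S = "emeasure (beta_mass d \<beta>) (space (lborel_dim d))"
  have "ennreal ((\<kappa> * (1 - \<delta>)) powr (real d / 2 + \<beta>) * (\<kappa> * \<delta> / 8)) * ?S
    = ennreal (b ^ d) * (ennreal ((\<kappa> * (1 - \<delta>)) powr \<beta>) * (ennreal (\<eta> / 4) * ?S))"
  proof -
    have "b ^ d = (\<kappa> * (1 - \<delta>)) powr (real d / 2)"
      using \<kappa> assms b by (simp add: b_def powr_half_sqrt[symmetric] powr_powr flip: powr_realpow)
    then have eq: "(\<kappa> * (1 - \<delta>)) powr (real d / 2 + \<beta>) * (\<kappa> * \<delta> / 8)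
       = b ^ d * ((\<kappa> * (1 - \<delta>)) powr \<beta> * (\<eta> / 4))"
      by (simp add: powr_add \<eta>_def)
    show ?thesis unfolding eq using b \<eta> by (simp add: ennreal_mult mult.assoc del: times_divide_eq_right)
  qed
  also have "\<dots> \<le> ennreal (b ^ d) * (ennreal ((\<kappa> * (1 - \<delta>)) powr \<beta>) * emeasure (beta_mass d \<beta>) (slab d u 0 \<eta>))"
    using \<eta> assms by (intro mult_left_mono beta_mass_slab_lower) auto
  also have "\<dots> = ennreal (b ^ d) * (\<integral>\<^sup>+z. ennreal ((\<kappa> * (1 - \<delta>)) powr \<beta>) *
      (ennreal (beta_profile d \<beta> z) * indicator (slab d u 0 \<eta>) z) \<partial>lborel_dim d)"
    by (subst nn_integral_cmult) (auto simp: emeasure_beta_mass)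
  also have "\<dots> \<le> emeasure (beta_mass d \<beta>) (cap d u r)"
    unfolding emeasure_beta_mass_cap_affine[OF b(1) u]
  proof (intro mult_left_mono nn_integral_mono)
    fix z
    show "ennreal ((\<kappa> * (1 - \<delta>)) powr \<beta>) * (ennreal (beta_profile d \<beta> z) * indicator (slab d u 0 \<eta>) z)
      \<le> ennreal (beta_profile d \<beta> (affine_dim d (\<lambda>i. r * u i) b z)) * indicator (cap d u 0) z"
    proof (cases "z \<in> slab d u 0 \<eta>")
      case True
      then have "z \<in> cap d u 0" by (simp add: slab_def cap_def)
      then show ?thesis using key[OF True] True
        by (simp add: ennreal_mult[symmetric] beta_profile_nonneg ennreal_leI)
    qed simp
  qed simp
  finally show ?thesis .
qed

section \<open>Cones and polar coordinates\<close>

text \<open>The origin is left out so that for r > 0 the cone is the preimage of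
  \<open>cap d u r\<close> under x \<mapsto> x / |x|, a map that sends the origin to the zero
  vector.\<close>

definition cone :: "nat \<Rightarrow> (nat \<Rightarrow> real) \<Rightarrow> real \<Rightarrow> (nat \<Rightarrow> real) set" where
  "cone d u r = {y \<in> space (lborel_dim d). 0 < norm_dim d y \<and> r * norm_dim d y \<le> inner_dim d u y}"

lemma cone_sets [measurable]: "cone d u r \<in> sets (lborel_dim d)"
proof -
  define f where "f y = inner_dim d u y - r * norm_dim d y" for y
  have [measurable]: "f \<in> borel_measurable (lborel_dim d)"
    unfolding f_def
    by (intro borel_measurable_diff borel_measurable_times measurable_inner_dim measurable_norm_dim
        borel_measurable_const)
  have "cone d u r = {y \<in> space (lborel_dim d). 0 < norm_dim d y \<and> 0 \<le> f y}"
    by (auto simp: cone_def f_def)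
  then show ?thesis by simp
qed

text \<open>Doubling fixes this set but multiplies its volume by 2 ^ d > 1. The statement is about
  the real-valued \<open>vol\<close>, which is also 0 for infinite measure; its use therefore comes
  with a separate finiteness argument.\<close>

lemma vol_origin:
  assumes "d > 0"
  shows "vol d (ball_dim d 0) = 0"
proof -
  have "norm_dim d (\<lambda>i\<in>{..<d}. y i / 2) \<le> 0 \<longleftrightarrow> norm_dim d y \<le> 0" for y :: "nat \<Rightarrow> real"
    using norm_dim_divide[of 2 y d] by linarith
  then have "emeasure (lborel_dim d) (ball_dim d 0)
      = ennreal (2 ^ d) * emeasure (lborel_dim d) (ball_dim d 0)"
    by (intro emeasure_scale_dim sets.Int unit_ball_sets ball_dim_sets) (auto simp: ball_dim_def space_lborel_dim)
  then have "vol d (ball_dim d 0) = 2 ^ d * vol d (ball_dim d 0)"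
    unfolding measure_def by (metis enn2real_mult enn2real_ennreal zero_le_numeral zero_le_power)
  moreover have "(2::real) ^ d > 1" using assms by (simp add: one_less_power)
  ultimately show ?thesis by simp
qed

text \<open>Uniform distributions on cones give the norm the same distribution function, \<open>a \<mapsto> a ^ d\<close>.\<close>

lemma polar_decomposition:
  assumes "d > 0" and [measurable]: "C \<in> sets (lborel_dim d)"
    and cone: "\<And>y c. y \<in> space (lborel_dim d) \<Longrightarrow> c > 0 \<Longrightarrow> (\<lambda>i\<in>{..<d}. y i / c) \<in> C \<longleftrightarrow> y \<in> C"
    and [measurable]: "g \<in> borel_measurable borel"
  shows "(\<integral>\<^sup>+y. g (norm_dim d y) * indicator (C \<inter> unit_ball d) y \<partial>lborel_dim d)
      = ennreal (vol d (C \<inter> unit_ball d) / vol d (unit_ball d))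
        * (\<integral>\<^sup>+y. g (norm_dim d y) * indicator (unit_ball d) y \<partial>lborel_dim d)"
proof -
  let ?L = "lborel_dim d" and ?B = "unit_ball d"
  have fin: "emeasure ?L (A \<inter> ?B) < \<infinity>" if "A \<in> sets ?L" for A
    using emeasure_mono[of "A \<inter> ?B" ?B ?L] emeasure_unit_ball_finite[of d] that
    by (auto intro: le_less_trans)
  show ?thesis
  proof (cases "emeasure ?L (C \<inter> ?B) = 0")
    \<comment> \<open>No uniform distribution on \<open>C \<inter> ?B\<close> exists here, but both
      sides are 0.\<close>
    case True
    then have "(\<integral>\<^sup>+y. g (norm_dim d y) * indicator (C \<inter> ?B) y \<partial>?L) = 0"
      by (intro nn_integral_null_set) (auto simp: null_sets_def)
    then show ?thesis using True by (simp add: measure_def)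
  next
    case False
    \<comment> \<open>Stated for an arbitrary scale-invariant \<open>A\<close> because it is applied
      twice: to \<open>C\<close> and to the whole space, which stands for the full ball.\<close>
    have cdf: "measure (distr (uniform_measure ?L (A \<inter> ?B)) borel (norm_dim d)) {..a}
        = (if a \<le> 0 then 0 else if a \<ge> 1 then 1 else a ^ d)"
      if [measurable]: "A \<in> sets ?L" and nz: "emeasure ?L (A \<inter> ?B) \<noteq> 0"
        and A: "\<And>y c. y \<in> space ?L \<Longrightarrow> c > 0 \<Longrightarrow> (\<lambda>i\<in>{..<d}. y i / c) \<in> A \<longleftrightarrow> y \<in> A" for A a
    proof -
      have pos: "0 < measure ?L (A \<inter> ?B)"
        using nz fin[OF that(1)] by (simp add: measure_def enn2real_positive_iff zero_less_iff_neq_zero)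
      have "measure (distr (uniform_measure ?L (A \<inter> ?B)) borel (norm_dim d)) {..a}
         = measure (uniform_measure ?L (A \<inter> ?B)) (norm_dim d -` {..a} \<inter> space ?L)"
        by (subst measure_distr) auto
      also have "\<dots> = measure ?L ((A \<inter> ?B) \<inter> (norm_dim d -` {..a} \<inter> space ?L)) / measure ?L (A \<inter> ?B)"
        using nz fin[OF that(1)]
        by (intro measure_uniform_measure) (auto simp: less_top)
      also have "(A \<inter> ?B) \<inter> (norm_dim d -` {..a} \<inter> space ?L) = A \<inter> ?B \<inter> ball_dim d a"
        by (auto simp: ball_dim_def)
      also have "measure ?L (A \<inter> ?B \<inter> ball_dim d a) / measure ?L (A \<inter> ?B)
        = (if a \<le> 0 then 0 else if a \<ge> 1 then 1 else a ^ d)"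
      proof -
        consider "a \<le> 0" | "a \<ge> 1" | "0 < a" "a < 1" by linarith
        then show ?thesis
        proof cases
          case 1
          then have "A \<inter> ?B \<inter> ball_dim d a \<subseteq> ball_dim d 0" by (auto simp: ball_dim_def)
          moreover have "ball_dim d 0 \<in> null_sets ?L"
          proof -
            have "ball_dim d 0 \<subseteq> ?B" by (auto simp: unit_ball_eq ball_dim_def)
            then have "emeasure ?L (ball_dim d 0) < \<infinity>" using fin[of "ball_dim d 0"]
              by (simp add: Int_absorb2)
            then show ?thesis using vol_origin[OF assms(1)]
              by (auto simp: null_sets_def measure_def enn2real_eq_0_iff)
          qed
          ultimately have "measure ?L (A \<inter> ?B \<inter> ball_dim d a) = 0"
            by (metis measure_eq_0_null_sets null_sets_subset ball_dim_sets sets.Int that(1) unit_ball_sets)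
          then show ?thesis using 1 by simp
        next
          case 2
          then have "A \<inter> ?B \<inter> ball_dim d a = A \<inter> ?B" by (auto simp: ball_dim_def unit_ball_eq)
          then show ?thesis using 2 pos by simp
        next
          case 3
          \<comment> \<open>Cutting at radius a < 1 produces the copy of
            \<open>A \<inter> ?B\<close> scaled by a.\<close>
          have N: "norm_dim d (\<lambda>i\<in>{..<d}. y i / a) \<le> 1 \<longleftrightarrow> norm_dim d y \<le> a" for y :: "nat \<Rightarrow> real"
            using 3 by (simp add: norm_dim_divide divide_le_eq)
          have "emeasure ?L (A \<inter> ?B \<inter> ball_dim d a) = ennreal (a ^ d) * emeasure ?L (A \<inter> ?B)"
            using 3 A N
            by (intro emeasure_scale_dim sets.Int unit_ball_sets ball_dim_sets) (auto simp: ball_dim_def unit_ball_def space_lborel_dim)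
          then have "measure ?L (A \<inter> ?B \<inter> ball_dim d a) = a ^ d * measure ?L (A \<inter> ?B)"
            using 3 by (simp add: measure_def enn2real_mult)
          then show ?thesis using 3 pos by simp
        qed
      qed
      finally show ?thesis .
    qed
    have rd: "real_distribution (distr (uniform_measure ?L (A \<inter> ?B)) borel (norm_dim d))"
      if "A \<in> sets ?L" "emeasure ?L (A \<inter> ?B) \<noteq> 0" for A
    proof -
      have "prob_space (uniform_measure ?L (A \<inter> ?B))"
        using that fin[OF that(1)] by (intro prob_space_uniform_measure) auto
      then show ?thesis by (intro prob_space.real_distribution_distr) auto
    qed
    have sp: "space ?L \<inter> ?B = ?B" by (auto simp: unit_ball_eq ball_dim_def)
    have nzB: "emeasure ?L (space ?L \<inter> ?B) \<noteq> 0"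
      using emeasure_unit_ball_pos[of d] by (simp add: sp)
    \<comment> \<open>Equal distribution functions make the laws of the norm equal, so every
      measurable g of the norm has the same mean under both.\<close>
    have eq: "distr (uniform_measure ?L (C \<inter> ?B)) borel (norm_dim d)
       = distr (uniform_measure ?L (space ?L \<inter> ?B)) borel (norm_dim d)"
    proof (rule cdf_unique)
      show "cdf (distr (uniform_measure ?L (C \<inter> ?B)) borel (norm_dim d))
         = cdf (distr (uniform_measure ?L (space ?L \<inter> ?B)) borel (norm_dim d))"
        unfolding cdf_def fun_eq_iff
        using cdf[OF assms(2) False cone] cdf[OF sets.top nzB] by (auto simp: space_lborel_dim)
    qed (rule rd[OF assms(2) False] rd[OF sets.top nzB])+
    have int: "(\<integral>\<^sup>+t. g t \<partial>distr (uniform_measure ?L (A \<inter> ?B)) borel (norm_dim d))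
       = (\<integral>\<^sup>+y. g (norm_dim d y) * indicator (A \<inter> ?B) y \<partial>?L) / emeasure ?L (A \<inter> ?B)"
      if "A \<in> sets ?L" for A
      using that by (simp add: nn_integral_distr nn_integral_uniform_measure)
    have X: "(\<integral>\<^sup>+y. g (norm_dim d y) * indicator (C \<inter> ?B) y \<partial>?L) / emeasure ?L (C \<inter> ?B)
       = (\<integral>\<^sup>+y. g (norm_dim d y) * indicator ?B y \<partial>?L) / emeasure ?L ?B"
      using int[OF assms(2)] int[OF sets.top] eq by (simp add: sp)
    have eC: "emeasure ?L (C \<inter> ?B) = ennreal (measure ?L (C \<inter> ?B))"
      using fin[OF assms(2)] by (intro emeasure_eq_ennreal_measure) auto
    let ?m = "emeasure ?L (C \<inter> ?B)" and ?v = "emeasure ?L ?B"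
    let ?X = "\<integral>\<^sup>+y. g (norm_dim d y) * indicator (C \<inter> ?B) y \<partial>?L"
    let ?Y = "\<integral>\<^sup>+y. g (norm_dim d y) * indicator ?B y \<partial>?L"
    have "?X = ?X * ?m / ?m"
      using False fin[OF assms(2)] by (intro ennreal_mult_divide_eq[symmetric]) auto
    also have "\<dots> = ?m * (?X / ?m)" 
      by (simp only: ennreal_times_divide mult.commute[of ?m ?X])
    also have "\<dots> = ?m * (?Y / ?v)" by (simp only: X)
    also have "\<dots> = ?m / ?v * ?Y" 
      by (simp only: ennreal_times_divide mult.commute[of "?m / ?v" ?Y] mult.commute[of ?m ?Y])
    also have "?m / ?v = ennreal (vol d (C \<inter> ?B) / vol d ?B)"
      unfolding eC emeasure_unit_ball using vol_unit_ball_pos[of d] by (intro divide_ennreal) auto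
    finally show ?thesis .
  qed
qed

lemma cone_scale:
  assumes "y \<in> space (lborel_dim d)" "c > 0"
  shows "(\<lambda>i\<in>{..<d}. y i / c) \<in> cone d u r \<longleftrightarrow> y \<in> cone d u r"
proof -
  let ?z = "\<lambda>i\<in>{..<d}. y i / c"
  have "norm_dim d ?z = norm_dim d y / c" "inner_dim d u ?z = inner_dim d u y / c"
    using assms norm_dim_scale[of "1/c" y d] inner_dim_scale_right[of d u "1/c" y] by simp_all
  moreover have "r * (norm_dim d y / c) \<le> inner_dim d u y / c \<longleftrightarrow> r * norm_dim d y \<le> inner_dim d u y"
    using assms(2) by (simp add: divide_le_cancel)
  moreover have "0 < norm_dim d y / c \<longleftrightarrow> 0 < norm_dim d y" using assms(2) by (simp add: zero_less_divide_iff)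
  ultimately show ?thesis using assms(1) by (simp add: cone_def space_lborel_dim)
qed

text \<open>The sphere and the ball of radius t < 1 are disjoint inside the unit ball, which leaves
  the sphere at most the share 1 - t ^ d; now t tends to 1.\<close>

lemma unit_sphere_null:
  assumes "d > 0"
  shows "{y \<in> space (lborel_dim d). norm_dim d y = 1} \<in> null_sets (lborel_dim d)" (is "?S \<in> _")
proof -
  let ?L = "lborel_dim d" and ?V = "vol d (unit_ball d)"
  have S [measurable]: "?S \<in> sets ?L" by measurable
  have fm: "ball_dim d r \<in> fmeasurable ?L" if "r > 0" for r
    using that by (intro fmeasurableI) (auto simp: emeasure_ball_dim)
  have mb: "measure ?L (ball_dim d r) = r ^ d * ?V" if "r > 0" for r
    using that by (simp add: measure_def emeasure_ball_dim)
  have SB: "?S \<in> fmeasurable ?L"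
    by (rule fmeasurableI2[OF fm[of 1]]) (auto simp: ball_dim_def)
  have bd: "measure ?L ?S \<le> (1 - (1 - 1 / real (Suc (Suc k))) ^ d) * ?V" for k
  proof -
    \<comment> \<open>The double successor keeps t positive already at k = 0.\<close>
    define t where "t = 1 - 1 / real (Suc (Suc k))"
    have t: "0 < t" "t < 1" by (auto simp: t_def)
    have "measure ?L ?S + measure ?L (ball_dim d t) = measure ?L (?S \<union> ball_dim d t)"
      using SB fm[OF t(1)] t by (intro measure_Un_AE[symmetric]) (auto simp: ball_dim_def)
    also have "\<dots> \<le> measure ?L (ball_dim d 1)"
      using t by (intro measure_mono_fmeasurable fm) (auto simp: ball_dim_def)
    finally show ?thesis using mb[OF t(1)] mb[of 1] by (simp add: t_def algebra_simps)
  qed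
  have "(\<lambda>k. (1 - (1 - 1 / real (Suc (Suc k))) ^ d) * ?V) \<longlonglongrightarrow> (1 - (1 - 0) ^ d) * ?V"
    by (intro tendsto_intros LIMSEQ_Suc[OF LIMSEQ_inverse_real_of_nat[unfolded inverse_eq_divide]])
  then have "measure ?L ?S \<le> (1 - (1 - 0) ^ d) * ?V"
    by (rule LIMSEQ_le_const) (use bd in blast)
  then have "measure ?L ?S = 0" using measure_nonneg[of ?L ?S] by simp
  then show ?thesis using SB by (auto simp: null_sets_def fmeasurable_def measure_def enn2real_eq_0_iff)
qed

lemma AE_norm_dim_neq_1: "d > 0 \<Longrightarrow> AE y in lborel_dim d. norm_dim d y \<noteq> 1"
  using unit_sphere_null[of d] by (intro AE_I'[of "{y \<in> space (lborel_dim d). norm_dim d y = 1}"]) auto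

text \<open>For \<beta> = 0 the profile is the indicator of the open ball, while
  \<open>unit_ball\<close> is closed; the difference is the null sphere.\<close>

lemma emeasure_beta_mass_0:
  assumes "d > 0" and [measurable]: "A \<in> sets (lborel_dim d)"
  shows "emeasure (beta_mass d 0) A = emeasure (lborel_dim d) (A \<inter> unit_ball d)"
proof -
  have "emeasure (beta_mass d 0) A = (\<integral>\<^sup>+x. indicator (A \<inter> unit_ball d) x \<partial>lborel_dim d)"
    unfolding emeasure_beta_mass[OF assms(2)]
    using AE_norm_dim_neq_1[OF assms(1)] AE_space[of "lborel_dim d"]
  proof (intro nn_integral_cong_AE, eventually_elim)
    case (elim x)
    then show ?case
      using norm_dim_less_one_iff[of x d]
      by (cases "norm_dim d x < 1") (auto simp: beta_profile_def indicator_def unit_ball_eq ball_dim_def)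
  qed
  then show ?thesis by simp
qed

section \<open>Caps of the beta distributions\<close>

text \<open>For r > 0 this is the normalised surface measure of the spherical cap of height r around
  u.\<close>

definition cone_ratio :: "nat \<Rightarrow> (nat \<Rightarrow> real) \<Rightarrow> real \<Rightarrow> real" where
  "cone_ratio d u r = vol d (cone d u r \<inter> unit_ball d) / vol d (unit_ball d)"

lemma cone_ratio_nonneg: "0 \<le> cone_ratio d u r"
  by (simp add: cone_ratio_def)

lemma polar_cone:
  assumes "d > 0" "g \<in> borel_measurable borel"
  shows "(\<integral>\<^sup>+y. g (norm_dim d y) * indicator (cone d u r \<inter> unit_ball d) y \<partial>lborel_dim d)
      = ennreal (cone_ratio d u r)
        * (\<integral>\<^sup>+y. g (norm_dim d y) * indicator (unit_ball d) y \<partial>lborel_dim d)"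
  unfolding cone_ratio_def using assms by (intro polar_decomposition cone_sets cone_scale) auto

lemma unit_ball_fmeasurable: "A \<in> sets (lborel_dim d) \<Longrightarrow> A \<inter> unit_ball d \<in> fmeasurable (lborel_dim d)"
  by (rule fmeasurableI2[of "unit_ball d"])
    (auto intro!: fmeasurableI emeasure_unit_ball_finite[simplified])

lemma emeasure_unit_ball_Int:
  "A \<in> sets (lborel_dim d) \<Longrightarrow>
    emeasure (lborel_dim d) (A \<inter> unit_ball d) = ennreal (vol d (A \<inter> unit_ball d))"
  using unit_ball_fmeasurable[of A d] by (intro emeasure_eq_measure2) auto

section \<open>Cones against caps in the uniform ball\<close>

definition shell :: "nat \<Rightarrow> real \<Rightarrow> (nat \<Rightarrow> real) set" where
  "shell d t = {y \<in> space (lborel_dim d). t \<le> norm_dim d y}"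

lemma shell_sets [measurable]: "shell d t \<in> sets (lborel_dim d)"
  unfolding shell_def by measurable

lemma vol_shell_ge:
  assumes "0 < t" "t \<le> 1"
  shows "(1 - t ^ d) * vol d (unit_ball d) \<le> vol d (shell d t \<inter> unit_ball d)"
proof -
  have "vol d (unit_ball d) \<le> vol d (ball_dim d t \<union> (shell d t \<inter> unit_ball d))"
    using assms
    by (intro measure_mono_fmeasurable fmeasurable.Un unit_ball_fmeasurable unit_ball_sets shell_sets)
      (auto simp: unit_ball_eq ball_dim_def shell_def intro!: fmeasurableI2[OF unit_ball_fmeasurable[OF sets.top]] )
  also have "\<dots> \<le> vol d (ball_dim d t) + vol d (shell d t \<inter> unit_ball d)"
    by (intro measure_Un_le) auto
  also have "vol d (ball_dim d t) = t ^ d * vol d (unit_ball d)"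
    using assms by (simp add: measure_def emeasure_ball_dim)
  finally show ?thesis by (simp add: algebra_simps)
qed

text \<open>The part of the cone with |y| \<ge> t lies in the cap of height t r. Norm and direction
  are independent, so this part is the fraction 1 - t ^ d of the cone, up to the bound for the
  shell.\<close>

lemma cone_ratio_le_cap:
  assumes "d > 0" "0 < t" "t < 1" "0 < r"
  shows "cone_ratio d u r * (1 - t ^ d) \<le> vol d (cap d u (t * r) \<inter> unit_ball d) / vol d (unit_ball d)"
proof -
  let ?L = "lborel_dim d" and ?B = "unit_ball d" and ?V = "vol d (unit_ball d)"
  have V: "?V > 0" by (rule vol_unit_ball_pos)
  have "ennreal (cone_ratio d u r * ((1 - t ^ d) * ?V)) = ennreal (cone_ratio d u r) * ennreal ((1 - t ^ d) * ?V)"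
    using V assms by (intro ennreal_mult) (auto simp: cone_ratio_nonneg power_le_one)
  also have "\<dots> \<le> ennreal (cone_ratio d u r) * emeasure ?L (shell d t \<inter> ?B)"
    unfolding emeasure_unit_ball_Int[OF shell_sets]
    using assms by (intro mult_left_mono ennreal_leI vol_shell_ge) auto
  also have "emeasure ?L (shell d t \<inter> ?B) = (\<integral>\<^sup>+y. indicator {t..} (norm_dim d y) * indicator ?B y \<partial>?L)"
    by (rule trans[OF nn_integral_indicator[symmetric] nn_integral_cong])
      (auto simp: indicator_def shell_def)
  also have "ennreal (cone_ratio d u r) * \<dots>
     = (\<integral>\<^sup>+y. indicator {t..} (norm_dim d y) * indicator (cone d u r \<inter> ?B) y \<partial>?L)"
    using assms by (intro polar_cone[symmetric]) auto
  also have "\<dots> \<le> (\<integral>\<^sup>+y. indicator (cap d u (t * r) \<inter> ?B) y \<partial>?L)"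
  proof (intro nn_integral_mono)
    fix y assume y: "y \<in> space ?L"
    have "t * r \<le> inner_dim d u y" if "t \<le> norm_dim d y" "r * norm_dim d y \<le> inner_dim d u y"
      using mult_right_mono[OF that(1) less_imp_le[OF assms(4)]] that(2)
      by (simp add: mult.commute[of r])
    then show "indicator {t..} (norm_dim d y) * indicator (cone d u r \<inter> ?B) y
       \<le> (indicator (cap d u (t * r) \<inter> ?B) y :: ennreal)"
      using y by (auto simp: indicator_def cone_def cap_def)
  qed
  also have "\<dots> = ennreal (vol d (cap d u (t * r) \<inter> ?B))"
    by (simp add: emeasure_unit_ball_Int[symmetric])
  finally have "cone_ratio d u r * ((1 - t ^ d) * ?V) \<le> vol d (cap d u (t * r) \<inter> ?B)"
    by (simp add: ennreal_le_iff)
  then show ?thesis using V by (simp add: field_simps)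
qed

text \<open>In the unit ball \<langle>u, y\<rangle> \<ge> r gives \<langle>u, y\<rangle> \<ge> r
  |y|, and r > 0 keeps y away from the origin.\<close>

lemma cap_le_cone_ratio:
  assumes "0 < r"
  shows "vol d (cap d u r \<inter> unit_ball d) / vol d (unit_ball d) \<le> cone_ratio d u r"
proof -
  have "cap d u r \<inter> unit_ball d \<subseteq> cone d u r \<inter> unit_ball d"
  proof
    fix y assume y: "y \<in> cap d u r \<inter> unit_ball d"
    then have n1: "norm_dim d y \<le> 1" "r \<le> inner_dim d u y" by (auto simp: unit_ball_def cap_def)
    have "0 < inner_dim d u y" using assms n1 by linarith
    then have "norm_dim d y \<noteq> 0"
      using inner_dim_le_norm[of d u y] by auto
    then have "0 < norm_dim d y" by (simp add: order.not_eq_order_implies_strict)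
    moreover have "r * norm_dim d y \<le> r" using n1 assms by (simp add: mult_left_le)
    ultimately show "y \<in> cone d u r \<inter> unit_ball d" using y n1 by (auto simp: cone_def cap_def)
  qed
  then have "vol d (cap d u r \<inter> unit_ball d) \<le> vol d (cone d u r \<inter> unit_ball d)"
    by (intro measure_mono_fmeasurable unit_ball_fmeasurable) auto
  then show ?thesis unfolding cone_ratio_def by (intro divide_right_mono) auto
qed

lemma vol_cap_eq:
  assumes "d > 0"
  shows "emeasure (beta_mass d 0) (cap d u r) = ennreal (vol d (cap d u r \<inter> unit_ball d))"
    and "emeasure (beta_mass d 0) (space (lborel_dim d)) = ennreal (vol d (unit_ball d))"
proof -
  have "space (lborel_dim d) \<inter> unit_ball d = unit_ball d" by (auto simp: unit_ball_eq ball_dim_def)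
  then show "emeasure (beta_mass d 0) (space (lborel_dim d)) = ennreal (vol d (unit_ball d))"
    using assms by (simp add: emeasure_beta_mass_0 emeasure_unit_ball)
  show "emeasure (beta_mass d 0) (cap d u r) = ennreal (vol d (cap d u r \<inter> unit_ball d))"
    using assms by (simp add: emeasure_beta_mass_0 emeasure_unit_ball_Int)
qed

text \<open>The case \<beta> = 0 of the similarity estimate. Together with its lower counterpart it
  is the benchmark for all negative exponents.\<close>

lemma vol_cap_upper:
  assumes "d > 0" "0 \<le> r" "r < 1" "norm_dim d u = 1"
  shows "vol d (cap d u r \<inter> unit_ball d) / vol d (unit_ball d) \<le> (1 - r\<^sup>2) powr (real d / 2)"
proof -
  have "ennreal (vol d (cap d u r \<inter> unit_ball d))
     \<le> ennreal ((1 - r\<^sup>2) powr (real d / 2) * vol d (unit_ball d))"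
    using beta_mass_cap_upper[where \<beta> = 0 and r = r and u = u and d = d] assms by (simp add: vol_cap_eq ennreal_mult)
  then show ?thesis using vol_unit_ball_pos[of d] by (simp add: ennreal_le_iff field_simps)
qed

lemma vol_cap_lower:
  assumes "d > 0" "0 \<le> r" "r < 1" "0 < \<delta>" "\<delta> < 1" "norm_dim d u = 1"
  shows "((1 - r\<^sup>2) * (1 - \<delta>)) powr (real d / 2) * ((1 - r\<^sup>2) * \<delta> / 8)
    \<le> vol d (cap d u r \<inter> unit_ball d) / vol d (unit_ball d)"
proof -
  have "r\<^sup>2 \<le> 1" using assms by (simp add: power_le_one)
  then have "ennreal (((1 - r\<^sup>2) * (1 - \<delta>)) powr (real d / 2) * ((1 - r\<^sup>2) * \<delta> / 8) * vol d (unit_ball d))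
    \<le> ennreal (vol d (cap d u r \<inter> unit_ball d))"
    using beta_mass_cap_lower[where \<beta> = 0 and r = r and \<delta> = \<delta> and u = u and d = d] assms
    by (simp add: vol_cap_eq ennreal_mult del: times_divide_eq_right)
  then show ?thesis using vol_unit_ball_pos[of d] by (simp add: ennreal_le_iff field_simps)
qed

text \<open>The Gamma quotient is hidden behind an unspecified c, whose product with the total mass
  is known as soon as the distribution is a probability measure.\<close>

lemma beta_distribution_eq_mass:
  assumes "\<beta> > -1"
  obtains c where "c \<ge> 0" "\<And>A. A \<in> sets (lborel_dim d) \<Longrightarrow>
      emeasure (beta_distribution d \<beta>) A = ennreal c * emeasure (beta_mass d \<beta>) A"
proof
  define c where "c = Gamma (real d / 2 + \<beta> + 1) / (pi powr (real d / 2) * Gamma (\<beta> + 1))"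
  have "0 < real d / 2 + \<beta> + 1" using assms by (smt (verit) divide_nonneg_pos of_nat_0_le_iff)
  then show c: "c \<ge> 0" using assms by (simp add: c_def Gamma_real_pos less_imp_le)
  fix A assume A: "A \<in> sets (lborel_dim d)"
  have eq: "beta_density d \<beta> x = c * beta_profile d \<beta> x" for x
    by (simp add: beta_density_def beta_profile_def c_def)
  show "emeasure (beta_distribution d \<beta>) A = ennreal c * emeasure (beta_mass d \<beta>) A"
    using assms A c unfolding beta_distribution_def eq
    by (simp add: emeasure_density emeasure_beta_mass ennreal_mult beta_profile_nonneg mult.assoc nn_integral_cmult)
qed

lemma sets_beta_distribution [simp, measurable_cong]:
  "sets (beta_distribution d \<beta>) = sets (lborel_dim d)"
  by (simp add: beta_distribution_def uniform_sphere_def)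

lemma space_beta_distribution [simp]: "space (beta_distribution d \<beta>) = space (lborel_dim d)"
  by (simp add: beta_distribution_def uniform_sphere_def)

lemma beta_cap_upper_nonneg:
  assumes P: "prob_space (beta_distribution d \<beta>)" and "\<beta> \<ge> 0" "0 \<le> r" "r < 1" "norm_dim d u = 1"
  shows "measure (beta_distribution d \<beta>) (cap d u r) \<le> (1 - r\<^sup>2) powr (real d / 2 + \<beta>)"
proof -
  interpret prob_space "beta_distribution d \<beta>" by fact
  obtain c where c: "c \<ge> 0" "\<And>A. A \<in> sets (lborel_dim d) \<Longrightarrow>
      emeasure (beta_distribution d \<beta>) A = ennreal c * emeasure (beta_mass d \<beta>) A"
    using beta_distribution_eq_mass[of \<beta> d] assms by auto
  \<comment> \<open>Total mass one takes the place of evaluating the Beta integral.\<close>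
  have 1: "ennreal c * emeasure (beta_mass d \<beta>) (space (lborel_dim d)) = 1"
    using c(2)[OF sets.top] emeasure_space_1 by simp
  have "emeasure (beta_distribution d \<beta>) (cap d u r)
    \<le> ennreal c * (ennreal ((1 - r\<^sup>2) powr (real d / 2 + \<beta>)) * emeasure (beta_mass d \<beta>) (space (lborel_dim d)))"
    unfolding c(2)[OF cap_sets] using assms by (intro mult_left_mono beta_mass_cap_upper) auto
  also have "\<dots> = ennreal ((1 - r\<^sup>2) powr (real d / 2 + \<beta>))"
    by (simp add: mult.left_commute[of "ennreal c"] 1)
  finally show ?thesis by (simp add: emeasure_eq_measure ennreal_le_iff)
qed

lemma beta_cap_lower_nonneg:
  assumes P: "prob_space (beta_distribution d \<beta>)" and "\<beta> \<ge> 0" "0 \<le> r" "r < 1" "0 < \<delta>" "\<delta> < 1"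
    "norm_dim d u = 1"
  shows "((1 - r\<^sup>2) * (1 - \<delta>)) powr (real d / 2 + \<beta>) * ((1 - r\<^sup>2) * \<delta> / 8)
    \<le> measure (beta_distribution d \<beta>) (cap d u r)"
proof -
  interpret prob_space "beta_distribution d \<beta>" by fact
  obtain c where c: "c \<ge> 0" "\<And>A. A \<in> sets (lborel_dim d) \<Longrightarrow>
      emeasure (beta_distribution d \<beta>) A = ennreal c * emeasure (beta_mass d \<beta>) A"
    using beta_distribution_eq_mass[of \<beta> d] assms by auto
  have 1: "ennreal c * emeasure (beta_mass d \<beta>) (space (lborel_dim d)) = 1"
    using c(2)[OF sets.top] emeasure_space_1 by simp
  let ?K = "((1 - r\<^sup>2) * (1 - \<delta>)) powr (real d / 2 + \<beta>) * ((1 - r\<^sup>2) * \<delta> / 8)"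
  have "ennreal ?K = ennreal c * (ennreal ?K * emeasure (beta_mass d \<beta>) (space (lborel_dim d)))"
    by (simp add: mult.left_commute[of "ennreal c"] 1)
  also have "\<dots> \<le> emeasure (beta_distribution d \<beta>) (cap d u r)"
    unfolding c(2)[OF cap_sets] using assms by (intro mult_left_mono beta_mass_cap_lower) auto
  finally show ?thesis by (simp add: emeasure_eq_measure ennreal_le_iff)
qed

section \<open>The sphere and the negative exponents\<close>

lemma measurable_normalise:
  "(\<lambda>x. \<lambda>i\<in>{..<d}. x i / norm_dim d x) \<in> lborel_dim d \<rightarrow>\<^sub>M lborel_dim d"
proof -
  have "(\<lambda>x. \<lambda>i\<in>{..<d}. x i / norm_dim d x) \<in> lborel_dim d \<rightarrow>\<^sub>M (\<Pi>\<^sub>M i\<in>{..<d}. borel)"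
    by (intro measurable_restrict borel_measurable_divide measurable_coordinate measurable_norm_dim) auto
  then show ?thesis by (simp add: measurable_cong_sets[OF refl sets_lborel_dim])
qed

lemma uniform_sphere_cap:
  assumes "0 < r"
  shows "measure (uniform_sphere d) (cap d u r) = cone_ratio d u r"
proof -
  let ?L = "lborel_dim d" and ?B = "unit_ball d"
  let ?f = "\<lambda>x. \<lambda>i\<in>{..<d}. x i / norm_dim d x"
  have f [measurable]: "?f \<in> ?L \<rightarrow>\<^sub>M ?L" by (rule measurable_normalise)
  have "?f -` cap d u r \<inter> space ?L = cone d u r"
  proof -
    have "r \<le> inner_dim d u (?f y) \<longleftrightarrow> 0 < norm_dim d y \<and> r * norm_dim d y \<le> inner_dim d u y" for y
    proof (cases "norm_dim d y = 0")
      \<comment> \<open>Division by zero yields the zero vector, which lies in no cap of positive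
        height; the cone omits the origin accordingly.\<close>
      case True
      then show ?thesis using assms by (simp add: inner_dim_def)
    next
      case False
      then have "0 < norm_dim d y" by (simp add: order.not_eq_order_implies_strict)
      moreover have "inner_dim d u (?f y) = inner_dim d u y / norm_dim d y"
        using inner_dim_scale_right[of d u "1 / norm_dim d y" y] by simp
      ultimately show ?thesis by (simp add: pos_le_divide_eq)
    qed
    then show ?thesis by (auto simp: cap_def cone_def space_lborel_dim)
  qed
  then have "measure (uniform_sphere d) (cap d u r) = measure (uniform_measure ?L ?B) (cone d u r)"
    unfolding uniform_sphere_def by (subst measure_distr) (auto simp: f)
  also have "\<dots> = measure ?L (?B \<inter> cone d u r) / measure ?L ?B"
    using emeasure_unit_ball_pos[of d] emeasure_unit_ball_finite[of d]
    by (intro measure_uniform_measure) auto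
  finally show ?thesis by (simp add: cone_ratio_def Int_commute)
qed

text \<open>The density depends on the norm alone, so direction and norm are independent and the
  direction is distributed as for the uniform ball. With t = 0 this feeds the upper bound for caps,
  with t near 1 the lower bound.\<close>

lemma beta_cone_shell:
  assumes P: "prob_space (beta_distribution d \<beta>)" and "d > 0" "\<beta> > -1"
  shows "measure (beta_distribution d \<beta>) (cone d u r \<inter> shell d t)
    = cone_ratio d u r * measure (beta_distribution d \<beta>) (shell d t)"
proof -
  interpret prob_space "beta_distribution d \<beta>" by fact
  obtain c where c: "c \<ge> 0" "\<And>A. A \<in> sets (lborel_dim d) \<Longrightarrow>
      emeasure (beta_distribution d \<beta>) A = ennreal c * emeasure (beta_mass d \<beta>) A"
    using beta_distribution_eq_mass[of \<beta> d] assms by auto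
  define g where "g s = ennreal ((if s < 1 then (1 - s\<^sup>2) powr \<beta> else 0) * indicator {t..} s)" for s :: real
  have g [measurable]: "g \<in> borel_measurable borel" unfolding g_def by measurable
  have m1: "emeasure (beta_mass d \<beta>) (cone d u r \<inter> shell d t)
     = (\<integral>\<^sup>+y. g (norm_dim d y) * indicator (cone d u r \<inter> unit_ball d) y \<partial>lborel_dim d)"
    unfolding emeasure_beta_mass[OF sets.Int[OF cone_sets shell_sets]]
    by (intro nn_integral_cong)
      (auto simp: g_def indicator_def beta_profile_def shell_def unit_ball_eq ball_dim_def cone_def)
  have m2: "emeasure (beta_mass d \<beta>) (shell d t)
     = (\<integral>\<^sup>+y. g (norm_dim d y) * indicator (unit_ball d) y \<partial>lborel_dim d)"
    unfolding emeasure_beta_mass[OF shell_sets]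
    by (intro nn_integral_cong)
      (auto simp: g_def indicator_def beta_profile_def shell_def unit_ball_eq ball_dim_def)
  have "emeasure (beta_distribution d \<beta>) (cone d u r \<inter> shell d t)
     = ennreal (cone_ratio d u r) * emeasure (beta_distribution d \<beta>) (shell d t)"
    unfolding c(2)[OF sets.Int[OF cone_sets shell_sets]] c(2)[OF shell_sets] m1 m2
      polar_cone[OF assms(2) g] by (simp add: mult.left_commute)
  then show ?thesis
    by (simp add: emeasure_eq_measure ennreal_mult[symmetric] cone_ratio_nonneg)
qed

text \<open>For \<open>\<beta> \<le> 0\<close> the density increases with the norm, so the norm is stochastically larger than
  under the uniform distribution on the ball.\<close>

lemma beta_shell_ge:
  assumes P: "prob_space (beta_distribution d \<beta>)" and "d > 0" "\<beta> > -1" "\<beta> \<le> 0" "0 < t" "t < 1"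
  shows "1 - t ^ d \<le> measure (beta_distribution d \<beta>) (shell d t)"
proof -
  interpret prob_space "beta_distribution d \<beta>" by fact
  let ?L = "lborel_dim d" and ?B = "unit_ball d" and ?V = "vol d (unit_ball d)"
  obtain c where c: "c \<ge> 0" "\<And>A. A \<in> sets ?L \<Longrightarrow>
      emeasure (beta_distribution d \<beta>) A = ennreal c * emeasure (beta_mass d \<beta>) A"
    using beta_distribution_eq_mass[of \<beta> d] assms by auto
  \<comment> \<open>The density at radius t separates the two regions: the profile is at least l on
    the shell and at most l inside it.\<close>
  define l where "l = (1 - t\<^sup>2) powr \<beta>"
  have t2: "0 < 1 - t\<^sup>2" using assms by (simp add: power_less_one_iff abs_square_less_1)
  let ?S = "shell d t"
  let ?C = "space ?L - shell d t"
  have S: "ennreal l * emeasure (beta_mass d 0) ?S \<le> emeasure (beta_mass d \<beta>) ?S"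
  proof -
    have "ennreal l * emeasure (beta_mass d 0) ?S
      = (\<integral>\<^sup>+x. ennreal l * (ennreal (beta_profile d 0 x) * indicator ?S x) \<partial>?L)"
      by (subst nn_integral_cmult) (auto simp: emeasure_beta_mass)
    also have "\<dots> \<le> (\<integral>\<^sup>+x. ennreal (beta_profile d \<beta> x) * indicator ?S x \<partial>?L)"
    proof (intro nn_integral_mono)
      fix x
      have "l \<le> beta_profile d \<beta> x" if "x \<in> ?S" "norm_dim d x < 1"
      proof -
        have "t\<^sup>2 \<le> (norm_dim d x)\<^sup>2" using that assms by (auto simp: shell_def intro!: power_mono)
        then have "(1 - t\<^sup>2) powr \<beta> \<le> (1 - (norm_dim d x)\<^sup>2) powr \<beta>"
          using that assms by (intro powr_mono2') (auto simp: norm_dim_less_one_iff)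
        then show ?thesis using that by (simp add: beta_profile_def l_def)
      qed
      then show "ennreal l * (ennreal (beta_profile d 0 x) * indicator ?S x)
        \<le> ennreal (beta_profile d \<beta> x) * indicator ?S x"
        using norm_dim_less_one_iff[of x d]
        by (cases "norm_dim d x < 1") (auto simp: indicator_def beta_profile_def[of d 0] intro!: ennreal_leI)
    qed
    finally show ?thesis by (simp add: emeasure_beta_mass)
  qed
  have C: "emeasure (beta_mass d \<beta>) ?C \<le> ennreal l * emeasure (beta_mass d 0) ?C"
  proof -
    have "(\<integral>\<^sup>+x. ennreal (beta_profile d \<beta> x) * indicator ?C x \<partial>?L)
      \<le> (\<integral>\<^sup>+x. ennreal l * (ennreal (beta_profile d 0 x) * indicator ?C x) \<partial>?L)"
    proof (intro nn_integral_mono)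
      fix x
      have "beta_profile d \<beta> x \<le> l" if "x \<in> ?C" "norm_dim d x < 1"
      proof -
        have "(norm_dim d x)\<^sup>2 \<le> t\<^sup>2" using that assms by (auto simp: shell_def intro!: power_mono)
        then have "(1 - (norm_dim d x)\<^sup>2) powr \<beta> \<le> (1 - t\<^sup>2) powr \<beta>"
          using that assms t2 by (intro powr_mono2') auto
        then show ?thesis using that by (simp add: beta_profile_def l_def)
      qed
      then show "ennreal (beta_profile d \<beta> x) * indicator ?C x
        \<le> ennreal l * (ennreal (beta_profile d 0 x) * indicator ?C x)"
        using norm_dim_less_one_iff[of x d]
        by (cases "norm_dim d x < 1") (auto simp: indicator_def beta_profile_def[of d 0] beta_profile_def[of d \<beta>] intro!: ennreal_leI)
    qed
    also have "\<dots> = ennreal l * emeasure (beta_mass d 0) ?C"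
      by (subst nn_integral_cmult) (auto simp: emeasure_beta_mass)
    finally show ?thesis by (simp add: emeasure_beta_mass)
  qed
  define p where "p = prob ?S"
  have q: "prob ?C = 1 - p" using prob_compl[of ?S] by (simp add: p_def)
  have "ennreal (c * (l * ((1 - t ^ d) * ?V))) \<le> ennreal c * (ennreal l * ennreal (vol d (?S \<inter> ?B)))"
    using c assms vol_shell_ge[of t d]
    by (subst ennreal_mult[symmetric], simp_all add: l_def)+ (auto intro!: ennreal_leI mult_left_mono)
  also have "\<dots> \<le> emeasure (beta_distribution d \<beta>) ?S"
    using S assms by (simp add: c(2) emeasure_beta_mass_0 emeasure_unit_ball_Int mult_left_mono)
  finally have 1: "c * (l * ((1 - t ^ d) * ?V)) \<le> p" by (simp add: emeasure_eq_measure p_def)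
  have "emeasure (beta_distribution d \<beta>) ?C \<le> ennreal c * (ennreal l * ennreal (t ^ d * ?V))"
  proof -
    have "emeasure ?L (?C \<inter> ?B) \<le> ennreal (t ^ d * ?V)"
      unfolding emeasure_ball_dim[OF assms(5), symmetric]
      by (intro emeasure_mono) (auto simp: shell_def ball_dim_def)
    then show ?thesis using order_trans[OF C mult_left_mono] assms
      by (simp add: c(2) emeasure_beta_mass_0 mult_left_mono)
  qed
  also have "\<dots> = ennreal (c * (l * (t ^ d * ?V)))"
    using c assms by (simp add: ennreal_mult l_def)
  finally have 2: "1 - p \<le> c * (l * (t ^ d * ?V))"
    using c assms by (simp add: emeasure_eq_measure ennreal_le_iff q[symmetric] l_def)
  have td: "0 \<le> t ^ d" "t ^ d \<le> 1" using assms by (auto simp: power_le_one)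
  \<comment> \<open>Cross-multiplying the two bounds eliminates the common factor c l V, and 1 - t ^
    d \<le> p remains.\<close>
  have "(1 - p) * (1 - t ^ d) \<le> (c * (l * (t ^ d * ?V))) * (1 - t ^ d)"
    using 2 td by (intro mult_right_mono) auto
  also have "\<dots> = (c * (l * ((1 - t ^ d) * ?V))) * t ^ d" by simp
  also have "\<dots> \<le> p * t ^ d" using 1 td by (intro mult_right_mono) auto
  finally show ?thesis by (simp add: p_def algebra_simps)
qed

text \<open>Up to a null set the cap lies in the cone, whose probability
  \<open>cone_ratio d u r\<close> is the same for all these \<beta>. Comparing the cone with a cap
  of the uniform ball lowers the height to t r and costs the factor 1 - t ^ d.\<close>

lemma beta_cap_upper_neg:
  assumes P: "prob_space (beta_distribution d \<beta>)" and "d > 0" "\<beta> \<ge> -1" "\<beta> \<le> 0"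
    "0 < r" "r < 1" "0 < t" "t < 1" "norm_dim d u = 1"
  shows "measure (beta_distribution d \<beta>) (cap d u r)
    \<le> (1 - (t * r)\<^sup>2) powr (real d / 2) / (1 - t ^ d)"
proof -
  interpret prob_space "beta_distribution d \<beta>" by fact
  have td: "0 < 1 - t ^ d" using assms by (simp add: power_less_one_iff)
  have "t * r < 1 * 1" using assms by (intro mult_strict_mono) auto
  then have tr: "0 \<le> t * r" "t * r < 1" using assms by auto
  have "cone_ratio d u r * (1 - t ^ d) \<le> (1 - (t * r)\<^sup>2) powr (real d / 2)"
    using cone_ratio_le_cap[of d t r u] vol_cap_upper[of d "t * r" u] tr assms by linarith
  then have "cone_ratio d u r \<le> (1 - (t * r)\<^sup>2) powr (real d / 2) / (1 - t ^ d)"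
    using td by (simp add: pos_le_divide_eq)
  moreover have "measure (beta_distribution d \<beta>) (cap d u r) \<le> cone_ratio d u r"
  proof (cases "\<beta> = -1")
    case True
    then show ?thesis using assms by (simp add: beta_distribution_def uniform_sphere_cap)
  next
    case False
    then have \<beta>: "\<beta> > -1" using assms by simp
    obtain c where c: "c \<ge> 0" "\<And>A. A \<in> sets (lborel_dim d) \<Longrightarrow>
        emeasure (beta_distribution d \<beta>) A = ennreal c * emeasure (beta_mass d \<beta>) A"
      using beta_distribution_eq_mass[of \<beta> d] \<beta> by auto
    \<comment> \<open>Beyond the unit sphere a point of the cap may fail to lie in the cone; that
      region has probability 0.\<close>
    have sub: "cap d u r \<subseteq> cone d u r \<union> {y \<in> space (lborel_dim d). \<not> norm_dim d y < 1}"
    proof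
      fix y assume y: "y \<in> cap d u r"
      then have "0 < norm_dim d y" using inner_dim_le_norm[of d u y] assms by (auto simp: cap_def)
      moreover have "r * norm_dim d y \<le> r" if "norm_dim d y < 1" using that assms by (simp add: mult_left_le)
      ultimately show "y \<in> cone d u r \<union> {y \<in> space (lborel_dim d). \<not> norm_dim d y < 1}"
        using y by (auto simp: cap_def cone_def)
    qed
    have "emeasure (beta_mass d \<beta>) {y \<in> space (lborel_dim d). \<not> norm_dim d y < 1} = 0"
    proof -
      have [measurable]: "{y \<in> space (lborel_dim d). \<not> norm_dim d y < 1} \<in> sets (lborel_dim d)" by measurable
      have "emeasure (beta_mass d \<beta>) {y \<in> space (lborel_dim d). \<not> norm_dim d y < 1}
        = (\<integral>\<^sup>+y. 0 \<partial>lborel_dim d)"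
        by (subst emeasure_beta_mass, simp, intro nn_integral_cong)
          (auto simp: beta_profile_def indicator_def)
      then show ?thesis by simp
    qed
    then have z: "prob {y \<in> space (lborel_dim d). \<not> norm_dim d y < 1} = 0"
      using c(2)[of "{y \<in> space (lborel_dim d). \<not> norm_dim d y < 1}"] by (simp add: measure_def)
    have "prob (cap d u r) \<le> prob (cone d u r \<union> {y \<in> space (lborel_dim d). \<not> norm_dim d y < 1})"
      using sub by (intro finite_measure_mono) auto
    also have "\<dots> \<le> prob (cone d u r) + prob {y \<in> space (lborel_dim d). \<not> norm_dim d y < 1}"
      by (intro measure_Un_le) auto
    also have "prob (cone d u r) = cone_ratio d u r"
    proof -
      have "shell d 0 = space (lborel_dim d)" by (auto simp: shell_def)
      moreover have "cone d u r \<inter> space (lborel_dim d) = cone d u r" by (auto simp: cone_def)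
      ultimately show ?thesis using beta_cone_shell[OF P assms(2) \<beta>, of u r 0] prob_space by simp
    qed
    finally show ?thesis using z by simp
  qed
  ultimately show ?thesis by linarith
qed

text \<open>The reverse route: a cap of the uniform ball bounds the cone from below, and cone points
  with norm at least t lie in the cap of height t r. On the sphere the cap of height r already has
  the measure of the cone.\<close>

lemma beta_cap_lower_neg:
  assumes P: "prob_space (beta_distribution d \<beta>)" and "d > 0" "\<beta> \<ge> -1" "\<beta> \<le> 0"
    "0 < r" "r < 1" "0 < t" "t < 1" "0 < \<delta>" "\<delta> < 1" "norm_dim d u = 1"
  shows "(1 - t ^ d) * (((1 - r\<^sup>2) * (1 - \<delta>)) powr (real d / 2) * ((1 - r\<^sup>2) * \<delta> / 8))
    \<le> measure (beta_distribution d \<beta>) (cap d u (t * r))"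
proof -
  interpret prob_space "beta_distribution d \<beta>" by fact
  let ?K = "((1 - r\<^sup>2) * (1 - \<delta>)) powr (real d / 2) * ((1 - r\<^sup>2) * \<delta> / 8)"
  have td: "0 \<le> 1 - t ^ d" "1 - t ^ d \<le> 1" using assms by (auto simp: power_le_one)
  have K: "?K \<le> cone_ratio d u r"
    by (rule order_trans[OF vol_cap_lower cap_le_cone_ratio]) (use assms in auto)
  have "r\<^sup>2 \<le> 1" using assms by (simp add: power_le_one)
  then have K0: "0 \<le> ?K" using assms by simp
  show ?thesis
  proof (cases "\<beta> = -1")
    case True
    have "(1 - t ^ d) * ?K \<le> 1 * cone_ratio d u r"
      using td K K0 by (intro mult_mono) auto
    also have "\<dots> = prob (cap d u r)"
      using True assms by (simp add: beta_distribution_def uniform_sphere_cap)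
    also have "\<dots> \<le> prob (cap d u (t * r))"
    proof (intro finite_measure_mono)
      have "t * r \<le> r" using assms by (simp add: mult_left_le_one_le)
      then show "cap d u r \<subseteq> cap d u (t * r)" by (auto simp: cap_def)
    qed auto
    finally show ?thesis .
  next
    case False
    then have \<beta>: "\<beta> > -1" using assms by simp
    have "(1 - t ^ d) * ?K \<le> prob (shell d t) * cone_ratio d u r"
      using K K0 beta_shell_ge[OF P assms(2) \<beta> assms(4,7,8)] by (intro mult_mono) auto
    also have "\<dots> = prob (cone d u r \<inter> shell d t)"
      using beta_cone_shell[OF P assms(2) \<beta>, of u r t] by simp
    also have "\<dots> \<le> prob (cap d u (t * r))"
    proof (intro finite_measure_mono)
      show "cone d u r \<inter> shell d t \<subseteq> cap d u (t * r)"
      proof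
        fix y assume y: "y \<in> cone d u r \<inter> shell d t"
        then have "t * r \<le> norm_dim d y * r" using assms by (auto simp: shell_def intro!: mult_right_mono)
        then show "y \<in> cap d u (t * r)" using y by (auto simp: cone_def cap_def mult.commute)
      qed
    qed auto
    finally show ?thesis .
  qed
qed

lemma AE_beta_unit_ball:
  assumes P: "prob_space (beta_distribution d \<beta>)" and "\<beta> \<ge> -1"
  shows "AE y in beta_distribution d \<beta>. norm_dim d y \<le> 1"
proof (cases "\<beta> = -1")
  case True
  let ?f = "\<lambda>x. \<lambda>i\<in>{..<d}. x i / norm_dim d x"
  have f: "?f \<in> uniform_measure (lborel_dim d) (unit_ball d) \<rightarrow>\<^sub>M lborel_dim d"
    using measurable_normalise[of d] by simp
  have n: "norm_dim d (?f y) \<le> 1" for y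
  proof -
    have "norm_dim d (?f y) = \<bar>1 / norm_dim d y\<bar> * norm_dim d y"
      using norm_dim_scale[of "1 / norm_dim d y" y d] by simp
    also have "\<dots> \<le> 1" by (cases "norm_dim d y = 0") simp_all
    finally show ?thesis .
  qed
  show ?thesis unfolding True beta_distribution_def uniform_sphere_def
    by (simp, subst AE_distr_iff[OF f]) (use n in auto)
next
  case False
  then have eq: "beta_distribution d \<beta> = density (lborel_dim d) (\<lambda>x. ennreal (beta_density d \<beta> x))"
    by (simp add: beta_distribution_def)
  have [measurable]: "beta_density d \<beta> \<in> borel_measurable (lborel_dim d)"
    unfolding beta_density_def by measurable
  show ?thesis unfolding eq by (subst AE_density) (auto simp: beta_density_def)
qed

section \<open>Convex hulls of finitely many points\<close>

text \<open>Weights are defined on all naturals and vanish from n on, which places them in a product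
  of compact sets where Tychonoff's theorem gives compactness, hence a nearest convex
  combination.\<close>

definition simplex_weights :: "nat \<Rightarrow> (nat \<Rightarrow> real) set" where
  "simplex_weights n = {w. (\<forall>i. 0 \<le> w i) \<and> (\<forall>i\<ge>n. w i = 0) \<and> (\<Sum>i<n. w i) = 1}"

definition combination :: "nat \<Rightarrow> nat \<Rightarrow> (nat \<Rightarrow> nat \<Rightarrow> real) \<Rightarrow> (nat \<Rightarrow> real) \<Rightarrow> nat \<Rightarrow> real" where
  "combination d n p w = (\<lambda>j\<in>{..<d}. \<Sum>i<n. w i * p i j)"

lemma compact_simplex_weights: "compact (simplex_weights n)"
proof -
  let ?S = "\<lambda>i. if i < n then {0..1} else {0::real}"
  let ?K = "Pi\<^sub>E UNIV ?S"
  have "compactin (product_topology (\<lambda>_::nat. euclidean) UNIV) ?K"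
    by (subst compactin_PiE) auto
  then have K: "compact ?K" by (simp add: euclidean_product_topology)
  have "continuous_on UNIV (\<lambda>w::nat \<Rightarrow> real. \<Sum>i<n. w i)"
    by (intro continuous_on_sum continuous_on_product_coordinates)
  then have "closed ((\<lambda>w::nat \<Rightarrow> real. \<Sum>i<n. w i) -` {1})"
    by (intro closed_vimage) auto
  with K have "compact (?K \<inter> (\<lambda>w::nat \<Rightarrow> real. \<Sum>i<n. w i) -` {1})"
    by (intro compact_Int_closed)
  moreover have "?K \<inter> (\<lambda>w::nat \<Rightarrow> real. \<Sum>i<n. w i) -` {1} = simplex_weights n"
  proof (intro equalityI subsetI)
    fix w assume w: "w \<in> ?K \<inter> (\<lambda>w::nat \<Rightarrow> real. \<Sum>i<n. w i) -` {1}"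
    have "w i \<in> ?S i" for i using PiE_mem[of w UNIV ?S i] w by blast
    then have "0 \<le> w i" "i \<ge> n \<Longrightarrow> w i = 0" for i
      by (smt (verit) atLeastAtMost_iff singletonD, metis not_le singletonD)
    then show "w \<in> simplex_weights n" using w by (simp add: simplex_weights_def)
  next
    fix w assume w: "w \<in> simplex_weights n"
    have "w i \<le> 1" if "i < n" for i
    proof -
      have "w i \<le> (\<Sum>i<n. w i)"
        using that w by (intro member_le_sum) (auto simp: simplex_weights_def)
      then show ?thesis using w by (simp add: simplex_weights_def)
    qed
    then show "w \<in> ?K \<inter> (\<lambda>w::nat \<Rightarrow> real. \<Sum>i<n. w i) -` {1}"
      using w by (auto simp: simplex_weights_def)
  qed
  ultimately show ?thesis by simp
qed

lemma inner_dim_diff_right: "inner_dim d u (\<lambda>j. x j - y j) = inner_dim d u x - inner_dim d u y"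
  by (simp add: inner_dim_def algebra_simps sum_subtractf)

text \<open>The separating direction points from the nearest convex combination to the given point.\<close>

lemma separation_from_combinations:
  assumes "n > 0" and y: "y \<in> space (lborel_dim d)" "y \<notin> combination d n p ` simplex_weights n"
  obtains u where "\<And>i. i < n \<Longrightarrow> inner_dim d u (p i) < inner_dim d u y"
proof -
  define f where "f w = (\<Sum>j<d. (y j - (\<Sum>i<n. w i * p i j))\<^sup>2)" for w :: "nat \<Rightarrow> real"
  have "continuous_on UNIV f"
    unfolding f_def
    by (intro continuous_on_sum continuous_on_power continuous_on_diff continuous_on_mult
        continuous_on_const continuous_on_product_coordinates)
  \<comment> \<open>A vertex of the simplex shows that the minimum is taken over a nonempty
    set.\<close>
  moreover have "(\<lambda>i. if i = 0 then 1 else 0) \<in> simplex_weights n"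
    using assms(1) by (auto simp: simplex_weights_def)
  ultimately obtain w where w: "w \<in> simplex_weights n"
      and min: "\<And>w'. w' \<in> simplex_weights n \<Longrightarrow> f w \<le> f w'"
    using continuous_attains_inf[OF compact_simplex_weights, of n f]
      continuous_on_subset[of UNIV f "simplex_weights n"] by auto
  define q where "q j = (\<Sum>i<n. w i * p i j)" for j
  define v where "v j = y j - q j" for j
  have fw: "f w = inner_dim d v v"
    by (simp add: f_def inner_dim_def v_def q_def power2_eq_square)
  have vpos: "0 < inner_dim d v v"
  proof (rule ccontr)
    assume "\<not> 0 < inner_dim d v v"
    then have "(norm_dim d v)\<^sup>2 = 0" using norm_dim_power2[of v d] zero_le_power2[of "norm_dim d v"] by linarith
    then have "norm_dim d v = 0" by simp
    then have "\<forall>j<d. y j = q j" by (simp add: L2_set_eq_0_iff v_def)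
    then have "y = combination d n p w"
      using y(1) by (auto simp: combination_def q_def space_lborel_dim PiE_def extensional_def restrict_def)
    then show False using y(2) w by blast
  qed
  have le0: "inner_dim d v (\<lambda>j. p i j - q j) \<le> 0" if i: "i < n" for i
  proof (rule ccontr)
    define a where "a j = p i j - q j" for j
    define b where "b = inner_dim d v a"
    define c where "c = inner_dim d a a"
    have c0: "0 \<le> c" by (simp add: c_def norm_dim_power2[symmetric])
    have step: "2 * b \<le> t * c" if t: "0 < t" "t \<le> 1" for t
    proof -
      define w' where "w' k = (1 - t) * w k + (if k = i then t else 0)" for k
      have "w' \<in> simplex_weights n"
        using w t i by (auto simp: simplex_weights_def w'_def sum.distrib sum_distrib_left[symmetric])
      then have "f w \<le> f w'" by (rule min)
      moreover have "(\<Sum>k<n. w' k * p k j) = q j + t * a j" for j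
      proof -
        have "(\<Sum>k<n. w' k * p k j) = (\<Sum>k<n. (1 - t) * (w k * p k j) + (if k = i then t * p k j else 0))"
          by (intro sum.cong) (auto simp: w'_def algebra_simps)
        also have "\<dots> = (1 - t) * q j + t * p i j"
          using i by (simp add: sum.distrib sum_distrib_left[symmetric] q_def)
        finally show ?thesis by (simp add: a_def algebra_simps)
      qed
      then have "f w' = (\<Sum>j<d. (v j - t * a j)\<^sup>2)" by (simp add: f_def v_def algebra_simps)
      also have "\<dots> = inner_dim d v v - 2 * t * b + t\<^sup>2 * c"
        by (simp add: inner_dim_def b_def c_def power2_eq_square algebra_simps sum.distrib
            sum_subtractf sum_distrib_left)
      ultimately have "t * (2 * b) \<le> t * (t * c)" using fw by (simp add: power2_eq_square algebra_simps)
      then show ?thesis using t by simp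
    qed
    assume "\<not> inner_dim d v (\<lambda>j. p i j - q j) \<le> 0"
    then have b: "b > 0" by (simp add: b_def a_def[abs_def])
    have "c > 0" using step[of 1] b by simp
    \<comment> \<open>A step this short has t c \<le> b, which contradicts 2 b \<le> t c for b >
      0.\<close>
    then have "min 1 (b / c) * c \<le> b" by (simp add: min_def field_simps)
    moreover have "2 * b \<le> min 1 (b / c) * c" using b \<open>c > 0\<close> by (intro step) auto
    ultimately show False using b by simp
  qed
  have "inner_dim d v (p i) < inner_dim d v y" if "i < n" for i
  proof -
    have "inner_dim d v v = inner_dim d v y - inner_dim d v q"
      using inner_dim_diff_right[of d v y q] by (simp add: v_def[abs_def])
    then show ?thesis using le0[OF that] vpos by (simp add: inner_dim_diff_right)
  qed
  then show ?thesis by (rule that)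
qed

text \<open>\<open>convex_dim\<close> speaks of two points only; the induction splits off the last
  point and rescales the remaining weights to sum 1.\<close>

lemma combination_mem_convex:
  assumes "convex_dim d T" "\<And>i. i < n \<Longrightarrow> p i \<in> T" "\<And>i. i < n \<Longrightarrow> 0 \<le> w i" "(\<Sum>i<n. w i) = 1"
  shows "combination d n p w \<in> T"
  using assms(2-)
proof (induction n arbitrary: w)
  case (Suc n)
  have T: "T \<subseteq> ({..<d} \<rightarrow>\<^sub>E UNIV)" using assms(1) by (simp add: convex_dim_def)
  define s where "s = (\<Sum>i<n. w i)"
  have s0: "0 \<le> s" unfolding s_def using Suc.prems(2) by (intro sum_nonneg) auto
  have sw: "s + w n = 1" using Suc.prems(3) by (simp add: s_def)
  show ?case
  proof (cases "s = 0")
    \<comment> \<open>Rescaling by s is impossible, but then only \<open>p n\<close> has weight;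
      restricting it changes nothing because \<open>T\<close> consists of extensional
      functions.\<close>
    case True
    then have "w i = 0" if "i < n" for i
      using that Suc.prems(2) by (subst (asm) s_def, subst (asm) sum_nonneg_eq_0_iff) auto
    then have "combination d (Suc n) p w = restrict (p n) {..<d}"
      using True sw by (simp add: combination_def)
    also have "\<dots> = p n"
      using T Suc.prems(1)[of n] by (intro extensional_restrict) (auto simp: PiE_def)
    finally have "combination d (Suc n) p w = p n" .
    then show ?thesis using Suc.prems(1) by simp
  next
    case False
    let ?w = "\<lambda>i. w i / s"
    have "combination d n p ?w \<in> T"
      using Suc.prems False s0
      by (intro Suc.IH) (auto simp: s_def sum_divide_distrib[symmetric])
    then have "(\<lambda>j\<in>{..<d}. s * combination d n p ?w j + w n * p n j) \<in> T"
      using assms(1) Suc.prems s0 sw unfolding convex_dim_def by (meson lessI)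
    moreover have "(\<lambda>j\<in>{..<d}. s * combination d n p ?w j + w n * p n j) = combination d (Suc n) p w"
      using False by (auto simp: combination_def fun_eq_iff restrict_def sum_distrib_left)
    ultimately show ?thesis by simp
  qed
qed simp

lemma convex_dim_halfspace: "convex_dim d {y \<in> space (lborel_dim d). inner_dim d u y \<le> c}"
  unfolding convex_dim_def
proof (intro conjI ballI allI impI)
  fix x y :: "nat \<Rightarrow> real" and a b :: real
  assume H: "x \<in> {y \<in> space (lborel_dim d). inner_dim d u y \<le> c}"
    "y \<in> {y \<in> space (lborel_dim d). inner_dim d u y \<le> c}" "0 \<le> a" "0 \<le> b" "a + b = 1"
  have "inner_dim d u (\<lambda>i\<in>{..<d}. a * x i + b * y i) = a * inner_dim d u x + b * inner_dim d u y"
    by (simp add: inner_dim_def algebra_simps sum.distrib sum_distrib_left)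
  also have "\<dots> \<le> a * c + b * c" using H by (intro add_mono mult_left_mono) auto
  also have "\<dots> = c" using H by (simp flip: distrib_right)
  finally show "(\<lambda>i\<in>{..<d}. a * x i + b * y i) \<in> {y \<in> space (lborel_dim d). inner_dim d u y \<le> c}"
    by (simp add: space_lborel_dim)
qed (auto simp: space_lborel_dim)

text \<open>The half space bounded by the largest value of the functional at the points is convex
  and contains them all, hence it contains the hull.\<close>

lemma hull_mem_imp:
  fixes p :: "nat \<Rightarrow> nat \<Rightarrow> real"
  assumes "n > 0" "\<And>i. i < n \<Longrightarrow> p i \<in> space (lborel_dim d)" "y \<in> convex_dim d hull (p ` {..<n})"
  shows "y \<in> space (lborel_dim d)" "\<exists>i<n. inner_dim d u y \<le> inner_dim d u (p i)"
proof -
  define c where "c = Max ((\<lambda>i. inner_dim d u (p i)) ` {..<n})"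
  have "convex_dim d hull (p ` {..<n}) \<subseteq> {y \<in> space (lborel_dim d). inner_dim d u y \<le> c}"
    by (rule hull_minimal[of "p ` {..<n}" _ "convex_dim d"])
      (use assms(2) in \<open>auto simp: c_def intro!: Max_ge convex_dim_halfspace\<close>)
  with assms(3) have "y \<in> space (lborel_dim d)" "inner_dim d u y \<le> c" by auto
  moreover have "c \<in> (\<lambda>i. inner_dim d u (p i)) ` {..<n}"
    unfolding c_def using assms(1) by (intro Max_in) auto
  ultimately show "y \<in> space (lborel_dim d)" "\<exists>i<n. inner_dim d u y \<le> inner_dim d u (p i)" by auto
qed

lemma not_in_hull_separation:
  fixes p :: "nat \<Rightarrow> nat \<Rightarrow> real"
  assumes "n > 0" "y \<in> space (lborel_dim d)" "y \<notin> convex_dim d hull (p ` {..<n})"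
  obtains u where "\<And>i. i < n \<Longrightarrow> inner_dim d u (p i) < inner_dim d u y"
proof -
  have "combination d n p ` simplex_weights n \<subseteq> convex_dim d hull (p ` {..<n})"
    unfolding hull_def
    by (auto intro!: combination_mem_convex simp: simplex_weights_def)
  then have "y \<notin> combination d n p ` simplex_weights n" using assms(3) by blast
  then show ?thesis using separation_from_combinations[OF assms(1,2)] that by blast
qed

section \<open>Testing membership in the hull with countably many directions\<close>

definition rational_directions :: "nat \<Rightarrow> (nat \<Rightarrow> real) set" where
  "rational_directions d = ({..<d} \<rightarrow>\<^sub>E \<rat>)"

lemma countable_rational_directions: "countable (rational_directions d)"
  unfolding rational_directions_def by (intro countable_PiE) (auto simp: countable_rat)

text \<open>Finitely many strict inequalities survive a small perturbation of u, here rounding down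
  to multiples of 1 / k.\<close>

lemma rational_separation:
  fixes p :: "nat \<Rightarrow> nat \<Rightarrow> real"
  assumes "\<And>i. i < n \<Longrightarrow> inner_dim d u (p i) < inner_dim d u y"
  obtains v where "v \<in> rational_directions d" "\<And>i. i < n \<Longrightarrow> inner_dim d v (p i) < inner_dim d v y"
proof -
  define v where "v k = (\<lambda>j\<in>{..<d}. real_of_int \<lfloor>real k * u j\<rfloor> / real k)" for k
  have lim: "(\<lambda>k. real_of_int \<lfloor>real k * a\<rfloor> / real k) \<longlonglongrightarrow> a" for a
  proof (rule real_tendsto_sandwich[where f = "\<lambda>k. a - 1 / real k" and h = "\<lambda>k. a"])
    show "\<forall>\<^sub>F k in sequentially. a - 1 / real k \<le> real_of_int \<lfloor>real k * a\<rfloor> / real k"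
      using eventually_gt_at_top[of 0]
    proof eventually_elim
      case (elim k)
      have "real k * a - 1 \<le> real_of_int \<lfloor>real k * a\<rfloor>" by linarith
      then have "(real k * a - 1) / real k \<le> real_of_int \<lfloor>real k * a\<rfloor> / real k"
        by (intro divide_right_mono) auto
      then show ?case using elim by (simp add: diff_divide_distrib)
    qed
    show "\<forall>\<^sub>F k in sequentially. real_of_int \<lfloor>real k * a\<rfloor> / real k \<le> a"
      using eventually_gt_at_top[of 0] 
      by eventually_elim (simp add: divide_le_eq mult.commute[of a])
    have "(\<lambda>k. a - 1 / real k) \<longlonglongrightarrow> a - 0"
      by (intro tendsto_diff tendsto_const lim_1_over_n)
    then show "(\<lambda>k. a - 1 / real k) \<longlonglongrightarrow> a" by simp
  qed simp
  have "\<forall>\<^sub>F k in sequentially. inner_dim d (v k) (p i) < inner_dim d (v k) y" if "i < n" for i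
  proof -
    have conv: "(\<lambda>k. inner_dim d (v k) z) \<longlonglongrightarrow> inner_dim d u z" for z
      unfolding inner_dim_def v_def by (intro tendsto_sum tendsto_mult tendsto_const) (auto intro: lim)
    have "(\<lambda>k. inner_dim d (v k) y - inner_dim d (v k) (p i)) \<longlonglongrightarrow> inner_dim d u y - inner_dim d u (p i)"
      by (intro tendsto_diff conv)
    then have "\<forall>\<^sub>F k in sequentially. 0 < inner_dim d (v k) y - inner_dim d (v k) (p i)"
      using assms[OF that] by (intro order_tendstoD) auto
    then show ?thesis by eventually_elim simp
  qed
  then have "\<forall>\<^sub>F k in sequentially. \<forall>i\<in>{..<n}. inner_dim d (v k) (p i) < inner_dim d (v k) y"
    by (intro eventually_ball_finite) auto
  then obtain k where "\<forall>i\<in>{..<n}. inner_dim d (v k) (p i) < inner_dim d (v k) y"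
    using eventually_happens'[OF sequentially_bot] by blast
  moreover have "v k \<in> rational_directions d"
    by (auto simp: rational_directions_def v_def)
  ultimately show ?thesis using that by auto
qed

text \<open>The quantifiers range over a countable and a finite set, so this form is measurable
  jointly in y and the points.\<close>

lemma mem_hull_iff_rational:
  fixes p :: "nat \<Rightarrow> nat \<Rightarrow> real"
  assumes "n > 0" "\<And>i. i < n \<Longrightarrow> p i \<in> space (lborel_dim d)"
  shows "y \<in> convex_dim d hull (p ` {..<n}) \<longleftrightarrow>
    y \<in> space (lborel_dim d) \<and>
      (\<forall>u\<in>rational_directions d. \<exists>i<n. inner_dim d u y \<le> inner_dim d u (p i))"
proof
  assume "y \<in> convex_dim d hull (p ` {..<n})"
  then show "y \<in> space (lborel_dim d) \<and>
      (\<forall>u\<in>rational_directions d. \<exists>i<n. inner_dim d u y \<le> inner_dim d u (p i))"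
    using hull_mem_imp[of n p d y] assms by blast
next
  assume R: "y \<in> space (lborel_dim d) \<and>
      (\<forall>u\<in>rational_directions d. \<exists>i<n. inner_dim d u y \<le> inner_dim d u (p i))"
  show "y \<in> convex_dim d hull (p ` {..<n})"
  proof (rule ccontr)
    assume "y \<notin> convex_dim d hull (p ` {..<n})"
    then obtain u where "\<And>i. i < n \<Longrightarrow> inner_dim d u (p i) < inner_dim d u y"
      using not_in_hull_separation[of n y d p] assms(1) R by blast
    then obtain v where "v \<in> rational_directions d" "\<And>i. i < n \<Longrightarrow> inner_dim d v (p i) < inner_dim d v y"
      using rational_separation by blast
    then show False using R by (meson not_le)
  qed
qed

section \<open>Expected volume of a random hull\<close>

text \<open>The law \<mu> stays abstract: the volume bounds use only that it lives on the unit ball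
  and that its caps satisfy a given estimate.\<close>

locale random_points = prob_space M for M :: "'a measure" +
  fixes d n :: nat and X :: "nat \<Rightarrow> 'a \<Rightarrow> nat \<Rightarrow> real" and \<mu> :: "(nat \<Rightarrow> real) measure"
  assumes d_pos: "d > 0" and n_pos: "n > 0"
    and indep: "indep_vars (\<lambda>_. lborel_dim d) X {..<n}"
    and distr_X: "\<And>i. i < n \<Longrightarrow> distr M (lborel_dim d) (X i) = \<mu>"
    and AE_ball: "AE y in \<mu>. norm_dim d y \<le> 1"
begin

definition random_hull :: "'a \<Rightarrow> (nat \<Rightarrow> real) set" where
  "random_hull \<omega> = convex_dim d hull ((\<lambda>i. X i \<omega>) ` {..<n})"

lemma measurable_X: "i < n \<Longrightarrow> X i \<in> M \<rightarrow>\<^sub>M lborel_dim d"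
  using indep by (simp add: indep_vars_def)

lemma X_space: "i < n \<Longrightarrow> \<omega> \<in> space M \<Longrightarrow> X i \<omega> \<in> space (lborel_dim d)"
  using measurable_space[OF measurable_X] .

lemma prob_X:
  assumes "i < n" "A \<in> sets (lborel_dim d)"
  shows "prob (X i -` A \<inter> space M) = measure \<mu> A"
  using assms distr_X[OF assms(1)] measure_distr[OF measurable_X[OF assms(1)] assms(2)] by simp

lemma prob_space_\<mu>: "prob_space \<mu>"
  using prob_space_distr[OF measurable_X[OF n_pos]] distr_X[OF n_pos] by simp

lemma sets_\<mu>: "sets \<mu> = sets (lborel_dim d)"
  using distr_X[OF n_pos] sets_distr[of M "lborel_dim d" "X 0"] by simp

lemma AE_X_ball: "AE \<omega> in M. \<forall>i<n. norm_dim d (X i \<omega>) \<le> 1"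
proof -
  have "AE \<omega> in M. \<forall>i\<in>{..<n}. norm_dim d (X i \<omega>) \<le> 1"
  proof (rule AE_finite_allI)
    fix i assume "i \<in> {..<n}"
    then have i: "i < n" by simp
    show "AE \<omega> in M. norm_dim d (X i \<omega>) \<le> 1"
      using AE_ball unfolding distr_X[OF i, symmetric] by (rule AE_distrD[OF measurable_X[OF i]])
  qed simp
  then show ?thesis by eventually_elim simp
qed

text \<open>Measurability of this set gives both the measurability of the random volume and the
  exchange of the integrals over \<omega> and y.\<close>

definition hull_graph :: "('a \<times> (nat \<Rightarrow> real)) set" where
  "hull_graph = {z \<in> space (M \<Otimes>\<^sub>M lborel_dim d). snd z \<in> random_hull (fst z)}"

lemma random_hull_iff:
  assumes "\<omega> \<in> space M"
  shows "y \<in> random_hull \<omega> \<longleftrightarrow> y \<in> space (lborel_dim d) \<and>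
      (\<forall>u\<in>rational_directions d. \<exists>i\<in>{..<n}. inner_dim d u y \<le> inner_dim d u (X i \<omega>))"
  unfolding random_hull_def
  using mem_hull_iff_rational[of n "\<lambda>i. X i \<omega>" d y] n_pos X_space[OF _ assms] by auto

lemma hull_graph_sets: "hull_graph \<in> sets (M \<Otimes>\<^sub>M lborel_dim d)"
proof -
  have "hull_graph = {z \<in> space (M \<Otimes>\<^sub>M lborel_dim d).
      \<forall>u\<in>rational_directions d. \<exists>i\<in>{..<n}. inner_dim d u (snd z) \<le> inner_dim d u (X i (fst z))}"
    by (auto simp: hull_graph_def space_pair_measure random_hull_iff)
  also have "\<dots> \<in> sets (M \<Otimes>\<^sub>M lborel_dim d)"
  proof (intro sets.sets_Collect_countable_All' countable_rational_directions sets.sets_Collect_finite_Ex)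
    fix u i assume "i \<in> {..<n}"
    then have "(\<lambda>z. X i (fst z)) \<in> M \<Otimes>\<^sub>M lborel_dim d \<rightarrow>\<^sub>M lborel_dim d"
      using measurable_X by (intro measurable_compose[OF measurable_fst]) auto
    then have "(\<lambda>z. inner_dim d u (X i (fst z))) \<in> borel_measurable (M \<Otimes>\<^sub>M lborel_dim d)"
      by (rule measurable_compose[OF _ measurable_inner_dim])
    moreover have "(\<lambda>z. inner_dim d u (snd z)) \<in> borel_measurable (M \<Otimes>\<^sub>M lborel_dim d)"
      by (rule measurable_compose[OF measurable_snd measurable_inner_dim])
    ultimately show "{z \<in> space (M \<Otimes>\<^sub>M lborel_dim d). inner_dim d u (snd z) \<le> inner_dim d u (X i (fst z))}
        \<in> sets (M \<Otimes>\<^sub>M lborel_dim d)"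
      by (rule borel_measurable_le[rotated])
  qed auto
  finally show ?thesis .
qed

lemma hull_graph_section: "\<omega> \<in> space M \<Longrightarrow> Pair \<omega> -` hull_graph = random_hull \<omega>"
  by (auto simp: hull_graph_def space_pair_measure random_hull_iff)

lemma random_hull_sets: "\<omega> \<in> space M \<Longrightarrow> random_hull \<omega> \<in> sets (lborel_dim d)"
  using sets_Pair1[OF hull_graph_sets, of \<omega>] hull_graph_section by simp

lemma measurable_emeasure_hull:
  "(\<lambda>\<omega>. emeasure (lborel_dim d) (random_hull \<omega>)) \<in> borel_measurable M"
  using sigma_finite_measure.measurable_emeasure_Pair[OF sigma_finite_lborel_dim hull_graph_sets]
  by (rule measurable_cong[THEN iffD1, rotated]) (simp add: hull_graph_section)

lemma random_hull_subset_ball: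
  assumes "\<omega> \<in> space M" "\<forall>i<n. norm_dim d (X i \<omega>) \<le> 1"
  shows "random_hull \<omega> \<subseteq> unit_ball d"
proof
  fix y assume y: "y \<in> random_hull \<omega>"
  obtain i where i: "i < n" "inner_dim d y y \<le> inner_dim d y (X i \<omega>)"
    using hull_mem_imp(2)[of n "\<lambda>i. X i \<omega>" d y y] y X_space[OF _ assms(1)] n_pos
    unfolding random_hull_def by blast
  have "inner_dim d y (X i \<omega>) \<le> norm_dim d y * norm_dim d (X i \<omega>)" by (rule inner_dim_le_norm)
  also have "\<dots> \<le> norm_dim d y * 1" using assms(2) i by (intro mult_left_mono) auto
  finally have "(norm_dim d y)\<^sup>2 \<le> norm_dim d y" using i by (simp add: norm_dim_power2)
  then have "norm_dim d y \<le> 1" by (rule contrapos_pp) (simp add: power2_eq_square)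
  then show "y \<in> unit_ball d" using y assms(1) by (simp add: unit_ball_eq ball_dim_def random_hull_iff)
qed

text \<open>The Bochner integral of the real volume is 0 by default without integrability; the
  almost sure bound by the unit ball excludes this and allows all further work in
  \<open>ennreal\<close>.\<close>

lemma expected_volume_eq:
  "ennreal (\<integral>\<omega>. vol d (random_hull \<omega>) \<partial>M) = (\<integral>\<^sup>+\<omega>. emeasure (lborel_dim d) (random_hull \<omega>) \<partial>M)"
proof -
  have bound: "AE \<omega> in M. emeasure (lborel_dim d) (random_hull \<omega>) \<le> emeasure (lborel_dim d) (unit_ball d)"
    using AE_X_ball AE_space
  proof eventually_elim
    case (elim \<omega>)
    then show ?case using random_hull_subset_ball[of \<omega>] by (intro emeasure_mono) auto
  qed
  have eq: "AE \<omega> in M. ennreal (vol d (random_hull \<omega>)) = emeasure (lborel_dim d) (random_hull \<omega>)"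
    using bound
  proof eventually_elim
    case (elim \<omega>)
    then have "emeasure (lborel_dim d) (random_hull \<omega>) < \<infinity>"
      using emeasure_unit_ball_finite[of d] by (rule le_less_trans)
    then show ?case by (intro emeasure_eq_ennreal_measure[symmetric]) auto
  qed
  have "(\<lambda>\<omega>. vol d (random_hull \<omega>)) \<in> borel_measurable M"
    unfolding measure_def by (intro measurable_compose[OF measurable_emeasure_hull]) simp
  moreover have "AE \<omega> in M. norm (vol d (random_hull \<omega>)) \<le> vol d (unit_ball d)"
    using bound
  proof eventually_elim
    case (elim \<omega>)
    then have "enn2real (emeasure (lborel_dim d) (random_hull \<omega>)) \<le> enn2real (emeasure (lborel_dim d) (unit_ball d))"
      using emeasure_unit_ball_finite[of d] by (intro enn2real_mono) auto
    then show ?case by (simp add: measure_def)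
  qed
  ultimately have "integrable M (\<lambda>\<omega>. vol d (random_hull \<omega>))"
    by (intro integrable_const_bound)
  then have "ennreal (\<integral>\<omega>. vol d (random_hull \<omega>) \<partial>M) = (\<integral>\<^sup>+\<omega>. ennreal (vol d (random_hull \<omega>)) \<partial>M)"
    by (intro nn_integral_eq_integral[symmetric]) auto
  also have "\<dots> = (\<integral>\<^sup>+\<omega>. emeasure (lborel_dim d) (random_hull \<omega>) \<partial>M)"
    by (rule nn_integral_cong_AE[OF eq])
  finally show ?thesis .
qed

text \<open>In the direction u = y / |y| the point has height |y| > \<rho>, so some sample point
  must reach the cap of height \<rho>. A union bound over the n points remains.\<close>

lemma prob_mem_hull_le:
  assumes y: "y \<in> space (lborel_dim d)" and \<rho>: "0 < \<rho>" "\<rho> < norm_dim d y"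
    and q: "\<And>u. norm_dim d u = 1 \<Longrightarrow> measure \<mu> (cap d u \<rho>) \<le> q"
  shows "prob {\<omega> \<in> space M. y \<in> random_hull \<omega>} \<le> real n * q"
proof -
  define u where "u = (\<lambda>i\<in>{..<d}. (1 / norm_dim d y) * y i)"
  have u1: "norm_dim d u = 1" using norm_dim_scale[of "1 / norm_dim d y" y d] \<rho> by (simp add: u_def)
  have uy: "inner_dim d u y = norm_dim d y"
  proof -
    have "inner_dim d u y = inner_dim d y u" by (rule inner_dim_commute)
    also have "\<dots> = (1 / norm_dim d y) * (norm_dim d y)\<^sup>2"
      unfolding u_def inner_dim_scale_right norm_dim_power2 ..
    also have "\<dots> = norm_dim d y" using \<rho> by (simp add: power2_eq_square)
    finally show ?thesis .
  qed
  have m: "X i -` cap d u \<rho> \<inter> space M \<in> events" if "i < n" for i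
    using measurable_X[OF that] cap_sets by (rule measurable_sets)
  have "prob {\<omega> \<in> space M. y \<in> random_hull \<omega>} \<le> prob (\<Union>i<n. X i -` cap d u \<rho> \<inter> space M)"
  proof (rule finite_measure_mono)
    show "{\<omega> \<in> space M. y \<in> random_hull \<omega>} \<subseteq> (\<Union>i<n. X i -` cap d u \<rho> \<inter> space M)"
    proof
      fix \<omega> assume \<omega>: "\<omega> \<in> {\<omega> \<in> space M. y \<in> random_hull \<omega>}"
      then obtain i where "i < n" "inner_dim d u y \<le> inner_dim d u (X i \<omega>)"
        using hull_mem_imp(2)[of n "\<lambda>i. X i \<omega>" d y u] X_space[of _ \<omega>] n_pos
        unfolding random_hull_def by blast
      then show "\<omega> \<in> (\<Union>i<n. X i -` cap d u \<rho> \<inter> space M)"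
        using \<omega> uy \<rho> X_space[of i \<omega>] by (auto simp: cap_def)
    qed
    show "(\<Union>i<n. X i -` cap d u \<rho> \<inter> space M) \<in> events"
      by (rule sets.finite_UN) (use m in auto)
  qed
  also have "\<dots> \<le> (\<Sum>i<n. prob (X i -` cap d u \<rho> \<inter> space M))"
    using m by (intro finite_measure_subadditive_finite) auto
  also have "\<dots> \<le> (\<Sum>i<n. q)"
    using q[OF u1] by (intro sum_mono) (simp add: prob_X)
  finally show ?thesis by simp
qed

text \<open>After Fubini the integrand is the probability that a fixed y lies in the hull: at most 1
  for |y| \<le> \<rho>, at most n q between \<rho> and 1, and 0 outside the unit ball.\<close>

lemma expected_volume_upper:
  assumes \<rho>: "0 < \<rho>" "\<rho> < 1" and q: "\<And>u. norm_dim d u = 1 \<Longrightarrow> measure \<mu> (cap d u \<rho>) \<le> q" and "0 \<le> q"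
  shows "(\<integral>\<omega>. vol d (random_hull \<omega>) \<partial>M) \<le> (\<rho> ^ d + real n * q) * vol d (unit_ball d)"
proof -
  let ?L = "lborel_dim d"
  interpret L: sigma_finite_measure ?L by (rule sigma_finite_lborel_dim)
  interpret pair_sigma_finite M ?L ..
  have sec: "(\<lambda>\<omega>. (\<omega>, y)) -` hull_graph = {\<omega> \<in> space M. y \<in> random_hull \<omega>}" if "y \<in> space ?L" for y
    using that by (auto simp: hull_graph_def space_pair_measure)
  have "ennreal (\<integral>\<omega>. vol d (random_hull \<omega>) \<partial>M) = (\<integral>\<^sup>+\<omega>. emeasure ?L (Pair \<omega> -` hull_graph) \<partial>M)"
    unfolding expected_volume_eq by (intro nn_integral_cong) (simp add: hull_graph_section)
  also have "\<dots> = emeasure (M \<Otimes>\<^sub>M ?L) hull_graph"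
    by (rule L.emeasure_pair_measure_alt[OF hull_graph_sets, symmetric])
  also have "\<dots> = (\<integral>\<^sup>+y. emeasure M ((\<lambda>\<omega>. (\<omega>, y)) -` hull_graph) \<partial>?L)"
    by (rule emeasure_pair_measure_alt2[OF hull_graph_sets])
  also have "\<dots> \<le> (\<integral>\<^sup>+y. indicator (ball_dim d \<rho>) y + ennreal (real n * q) * indicator (unit_ball d) y \<partial>?L)"
  proof (rule nn_integral_mono)
    fix y assume y: "y \<in> space ?L"
    show "emeasure M ((\<lambda>\<omega>. (\<omega>, y)) -` hull_graph)
      \<le> indicator (ball_dim d \<rho>) y + ennreal (real n * q) * indicator (unit_ball d) y"
    proof (cases "norm_dim d y \<le> \<rho>")
      case True
      then have "y \<in> ball_dim d \<rho>" using y by (simp add: ball_dim_def)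
      then show ?thesis unfolding sec[OF y] using emeasure_le_1
        by (simp add: add_increasing2)
    next
      case False
      show ?thesis
      proof (cases "norm_dim d y \<le> 1")
        case True
        then have "y \<in> unit_ball d" using y by (simp add: unit_ball_eq ball_dim_def)
        moreover have "emeasure M {\<omega> \<in> space M. y \<in> random_hull \<omega>} \<le> ennreal (real n * q)"
          unfolding emeasure_eq_measure using False \<rho> q y by (intro ennreal_leI prob_mem_hull_le) auto
        ultimately show ?thesis unfolding sec[OF y] by (simp add: add_increasing)
      next
        case False
        have "AE \<omega> in M. \<omega> \<notin> {\<omega> \<in> space M. y \<in> random_hull \<omega>}"
          using AE_X_ball AE_space
        proof eventually_elim
          case (elim \<omega>)
          then show ?case using random_hull_subset_ball[of \<omega>] False by (auto simp: unit_ball_def)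
        qed
        moreover have "{\<omega> \<in> space M. y \<in> random_hull \<omega>} \<in> sets M"
          using sets_Pair2[OF hull_graph_sets, of y] by (simp add: sec[OF y])
        ultimately have "{\<omega> \<in> space M. y \<in> random_hull \<omega>} \<in> null_sets M"
          using AE_iff_null_sets by blast
        then show ?thesis unfolding sec[OF y] by (simp add: null_setsD1)
      qed
    qed
  qed
  also have "\<dots> = emeasure ?L (ball_dim d \<rho>) + ennreal (real n * q) * emeasure ?L (unit_ball d)"
    by (subst nn_integral_add) (auto simp: nn_integral_cmult)
  also have "\<dots> = ennreal ((\<rho> ^ d + real n * q) * vol d (unit_ball d))"
    using \<rho> assms(4) unfolding emeasure_ball_dim[OF \<rho>(1)] emeasure_unit_ball
    by (simp add: ennreal_mult'' ennreal_plus distrib_right)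
  finally show ?thesis
    using \<rho> assms(4) by (subst (asm) ennreal_le_iff) (auto intro!: mult_nonneg_nonneg add_nonneg_nonneg)
qed

section \<open>A finite grid of directions and the lower bound\<close>

definition grid :: "nat \<Rightarrow> (nat \<Rightarrow> real) set" where
  "grid K = ({..<d} \<rightarrow>\<^sub>E (\<lambda>k. real_of_int k / real K) ` {- int K..int K})"

lemma finite_grid: "finite (grid K)"
  unfolding grid_def by (intro finite_PiE) auto

lemma card_grid: "card (grid K) \<le> (2 * K + 1) ^ d"
proof -
  have "card (grid K) = (\<Prod>i<d. card ((\<lambda>k. real_of_int k / real K) ` {- int K..int K}))"
    unfolding grid_def by (rule card_PiE) auto
  also have "\<dots> \<le> (\<Prod>i<d. 2 * K + 1)"
    by (intro prod_mono conjI) (auto intro!: order_trans[OF card_image_le])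
  finally show ?thesis by simp
qed

text \<open>Rounding down costs at most 1 / K per coordinate, and the Euclidean norm is at most the
  sum of these errors.\<close>

lemma grid_approximation:
  assumes u: "norm_dim d u = 1" and "K > 0"
  obtains v where "v \<in> grid K" "norm_dim d (\<lambda>i. v i - u i) \<le> real d / real K"
proof -
  define v where "v = (\<lambda>i\<in>{..<d}. real_of_int \<lfloor>real K * u i\<rfloor> / real K)"
  have ui: "\<bar>u i\<bar> \<le> 1" if "i < d" for i
    using abs_coordinate_le_norm[OF that, of u] u by simp
  have fl: "\<lfloor>real K * u i\<rfloor> \<in> {- int K..int K}" if "i < d" for i
  proof -
    have "real K * u i \<le> real K * 1" "real K * (- 1) \<le> real K * u i"
      using ui[OF that] by (intro mult_left_mono; simp add: abs_le_iff)+
    then show ?thesis by (auto simp: le_floor_iff floor_le_iff)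
  qed
  have "v \<in> grid K" unfolding grid_def v_def using fl by (auto simp: PiE_def Pi_def)
  moreover have "norm_dim d (\<lambda>i. v i - u i) \<le> real d / real K"
  proof -
    have "norm_dim d (\<lambda>i. v i - u i) \<le> (\<Sum>i<d. \<bar>v i - u i\<bar>)" by (rule L2_set_le_sum_abs)
    also have "\<dots> \<le> (\<Sum>i<d. 1 / real K)"
    proof (rule sum_mono)
      fix i assume i: "i \<in> {..<d}"
      have "v i - u i = (real_of_int \<lfloor>real K * u i\<rfloor> - real K * u i) / real K"
        using i assms(2) by (simp add: v_def diff_divide_distrib)
      moreover have "\<bar>real_of_int \<lfloor>real K * u i\<rfloor> - real K * u i\<bar> \<le> 1" by linarith
      ultimately show "\<bar>v i - u i\<bar> \<le> 1 / real K" by (simp add: abs_divide divide_right_mono)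
    qed
    finally show ?thesis by simp
  qed
  ultimately show ?thesis using that by blast
qed

lemma inner_dim_diff_left: "inner_dim d (\<lambda>i. v i - u i) x = inner_dim d v x - inner_dim d u x"
  by (simp add: inner_dim_def algebra_simps sum_subtractf)

text \<open>A separating unit direction w has a grid vector v within d / K. Since sample points have
  norm at most 1, replacing v by w changes their heights by at most d / K, so some sample point has
  height at least \<rho> in direction w. But y, of height at most \<rho>, was to lie strictly above
  all of them.\<close>

lemma ball_subset_random_hull:
  fixes K :: nat
  assumes \<omega>: "\<omega> \<in> space M" "\<forall>i<n. norm_dim d (X i \<omega>) \<le> 1" and "K > 0"
    and good: "\<And>v. v \<in> grid K \<Longrightarrow> 1 - real d / real K \<le> norm_dim d v \<Longrightarrow>
      \<exists>i<n. \<rho> + real d / real K \<le> inner_dim d v (X i \<omega>)"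
  shows "ball_dim d \<rho> \<subseteq> random_hull \<omega>"
proof
  fix y assume y: "y \<in> ball_dim d \<rho>"
  show "y \<in> random_hull \<omega>"
  proof (rule ccontr)
    assume "y \<notin> random_hull \<omega>"
    then obtain u where u: "\<And>i. i < n \<Longrightarrow> inner_dim d u (X i \<omega>) < inner_dim d u y"
      using not_in_hull_separation[of n y d "\<lambda>i. X i \<omega>"] n_pos y
      unfolding random_hull_def ball_dim_def by blast
    have "norm_dim d u \<noteq> 0"
    proof
      assume "norm_dim d u = 0"
      then have "inner_dim d u z = 0" for z by (simp add: L2_set_eq_0_iff inner_dim_def)
      then show False using u[OF n_pos] by simp
    qed
    then have nu: "0 < norm_dim d u" by (simp add: order.not_eq_order_implies_strict)
    define w where "w = (\<lambda>i\<in>{..<d}. (1 / norm_dim d u) * u i)"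
    have w1: "norm_dim d w = 1" using norm_dim_scale[of "1 / norm_dim d u" u d] nu by (simp add: w_def)
    have wz: "inner_dim d w z = inner_dim d u z / norm_dim d u" for z
      unfolding inner_dim_commute[of d _ z] w_def inner_dim_scale_right by simp
    obtain v where v: "v \<in> grid K" "norm_dim d (\<lambda>i. v i - w i) \<le> real d / real K"
      using grid_approximation[OF w1 assms(3)] by blast
    have "1 \<le> norm_dim d v + norm_dim d (\<lambda>i. v i - w i)"
    proof -
      have "norm_dim d (\<lambda>i. w i - v i) = norm_dim d (\<lambda>i. v i - w i)"
        by (simp add: L2_set_def power2_commute)
      then show ?thesis using L2_set_triangle_ineq[of v "\<lambda>i. w i - v i" "{..<d}"] w1 by simp
    qed
    then obtain i where i: "i < n" "\<rho> + real d / real K \<le> inner_dim d v (X i \<omega>)"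
      using good[OF v(1)] v(2) by force
    have "inner_dim d (\<lambda>i. v i - w i) (X i \<omega>) \<le> norm_dim d (\<lambda>i. v i - w i) * norm_dim d (X i \<omega>)"
      by (rule inner_dim_le_norm)
    also have "\<dots> \<le> (real d / real K) * 1" using v(2) \<omega>(2) i by (intro mult_mono) auto
    finally have "inner_dim d v (X i \<omega>) \<le> inner_dim d w (X i \<omega>) + real d / real K"
      by (simp add: inner_dim_diff_left)
    moreover have "inner_dim d w (X i \<omega>) < inner_dim d w y"
      unfolding wz using u[OF i(1)] nu by (simp add: divide_strict_right_mono)
    moreover have "inner_dim d w y \<le> \<rho>"
      using inner_dim_le_norm[of d w y] w1 y by (simp add: ball_dim_def)
    ultimately show False using i(2) by linarith
  qed
qed

text \<open>Grid vectors are not normalised. The threshold c \<le> r \<epsilon> \<le> r |v| ensures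
  that a point in the cap of height r around v / |v| reaches c in direction v; independence then
  gives the n-th power.\<close>

lemma prob_direction_missed:
  assumes q: "\<And>u. norm_dim d u = 1 \<Longrightarrow> q \<le> measure \<mu> (cap d u r)"
    and "0 \<le> r" "0 < \<epsilon>" "\<epsilon> \<le> norm_dim d v" "c \<le> r * \<epsilon>"
  shows "prob {\<omega> \<in> space M. \<forall>i<n. inner_dim d v (X i \<omega>) < c} \<le> (1 - q) ^ n"
    and "{\<omega> \<in> space M. \<forall>i<n. inner_dim d v (X i \<omega>) < c} \<in> events"
proof -
  interpret \<mu>: prob_space \<mu> by (rule prob_space_\<mu>)
  define A where "A = space (lborel_dim d) - cap d v c"
  have A [measurable]: "A \<in> sets (lborel_dim d)" by (simp add: A_def)
  have eq: "{\<omega> \<in> space M. \<forall>i<n. inner_dim d v (X i \<omega>) < c} = (\<Inter>i\<in>{..<n}. X i -` A \<inter> space M)"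
    using n_pos X_space by (auto simp: A_def cap_def not_le)
  show "{\<omega> \<in> space M. \<forall>i<n. inner_dim d v (X i \<omega>) < c} \<in> events"
    unfolding eq using n_pos measurable_sets[OF measurable_X A] by (intro sets.finite_INT) auto
  define u where "u = (\<lambda>i\<in>{..<d}. (1 / norm_dim d v) * v i)"
  have nv: "0 < norm_dim d v" using assms by linarith
  have u1: "norm_dim d u = 1" using norm_dim_scale[of "1 / norm_dim d v" v d] nv by (simp add: u_def)
  have uz: "inner_dim d u z = inner_dim d v z / norm_dim d v" for z
    unfolding inner_dim_commute[of d _ z] u_def inner_dim_scale_right by simp
  have sub: "cap d u r \<subseteq> cap d v c"
  proof
    fix z assume z: "z \<in> cap d u r"
    have "c \<le> r * norm_dim d v" using assms(5) mult_left_mono[OF assms(4,2)] by linarith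
    also have "\<dots> \<le> inner_dim d v z" using z nv by (simp add: cap_def uz pos_le_divide_eq)
    finally show "z \<in> cap d v c" using z by (simp add: cap_def)
  qed
  have "q \<le> measure \<mu> (cap d v c)"
    using q[OF u1] \<mu>.finite_measure_mono[OF sub] by (simp add: sets_\<mu>)
  moreover have "measure \<mu> A = 1 - measure \<mu> (cap d v c)"
    using \<mu>.prob_compl[of "cap d v c"] sets_eq_imp_space_eq[OF sets_\<mu>] by (simp add: sets_\<mu> A_def)
  ultimately have mA: "measure \<mu> A \<le> 1 - q" by simp
  have "prob {\<omega> \<in> space M. \<forall>i<n. inner_dim d v (X i \<omega>) < c} = (\<Prod>i<n. prob (X i -` A \<inter> space M))"
    unfolding eq using n_pos by (intro indep_varsD[OF indep]) auto
  also have "\<dots> = measure \<mu> A ^ n" by (simp add: prob_X)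
  also have "\<dots> \<le> (1 - q) ^ n" using mA by (intro power_mono) auto
  finally show "prob {\<omega> \<in> space M. \<forall>i<n. inner_dim d v (X i \<omega>) < c} \<le> (1 - q) ^ n" .
qed

lemma expected_volume_lower:
  fixes K :: nat
  assumes \<rho>: "0 < \<rho>" "0 \<le> r" and q: "\<And>u. norm_dim d u = 1 \<Longrightarrow> q \<le> measure \<mu> (cap d u r)" "q \<le> 1"
    and K: "real d < real K" "\<rho> + real d / real K \<le> r * (1 - real d / real K)"
  shows "\<rho> ^ d * (1 - real (2 * K + 1) ^ d * (1 - q) ^ n) * vol d (unit_ball d)
    \<le> (\<integral>\<omega>. vol d (random_hull \<omega>) \<partial>M)"
proof -
  let ?L = "lborel_dim d" and ?e = "real d / real K"
  have Kpos: "K > 0" and e1: "0 < 1 - ?e" using K(1) by (auto simp: divide_less_eq)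
  \<comment> \<open>Only grid vectors this long can approximate a unit vector, and their length
    gives the \<epsilon> of \<open>prob_direction_missed\<close>.\<close>
  define G where "G = {v \<in> grid K. 1 - ?e \<le> norm_dim d v}"
  have fG: "finite G" unfolding G_def using finite_grid by auto
  define B where "B v = {\<omega> \<in> space M. \<forall>i<n. inner_dim d v (X i \<omega>) < \<rho> + ?e}" for v
  have B: "prob (B v) \<le> (1 - q) ^ n" "B v \<in> events" if "v \<in> G" for v
  proof -
    have v: "1 - ?e \<le> norm_dim d v" using that by (simp add: G_def)
    show "prob (B v) \<le> (1 - q) ^ n" "B v \<in> events"
      unfolding B_def
      by (rule prob_direction_missed[OF q(1) \<rho>(2) e1 v K(2)]; assumption)+
  qed
  define bad where "bad = (\<Union>v\<in>G. B v)"
  have bad [measurable]: "bad \<in> events" unfolding bad_def using fG B by auto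
  have "prob bad \<le> (\<Sum>v\<in>G. prob (B v))"
    unfolding bad_def using fG B by (intro finite_measure_subadditive_finite) auto
  also have "\<dots> \<le> real (card G) * (1 - q) ^ n"
    using sum_bounded_above[of G "\<lambda>v. prob (B v)" "(1 - q) ^ n"] B by simp
  also have "\<dots> \<le> real ((2 * K + 1) ^ d) * (1 - q) ^ n"
  proof (intro mult_right_mono)
    have "card G \<le> card (grid K)" unfolding G_def by (intro card_mono finite_grid) auto
    then show "real (card G) \<le> real ((2 * K + 1) ^ d)"
      using card_grid[of K] by (simp only: of_nat_le_iff)
  qed (use q(2) in auto)
  finally have pb: "prob bad \<le> real (2 * K + 1) ^ d * (1 - q) ^ n" by simp
  have "ennreal (\<rho> ^ d * vol d (unit_ball d) * prob (space M - bad))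
      = emeasure ?L (ball_dim d \<rho>) * emeasure M (space M - bad)"
    unfolding emeasure_ball_dim[OF \<rho>(1)] emeasure_eq_measure using \<rho> by (intro ennreal_mult) auto
  also have "\<dots> = (\<integral>\<^sup>+\<omega>. emeasure ?L (ball_dim d \<rho>) * indicator (space M - bad) \<omega> \<partial>M)"
    by (subst nn_integral_cmult_indicator) auto
  also have "\<dots> \<le> (\<integral>\<^sup>+\<omega>. emeasure ?L (random_hull \<omega>) \<partial>M)"
  proof (rule nn_integral_mono_AE)
    show "AE \<omega> in M. emeasure ?L (ball_dim d \<rho>) * indicator (space M - bad) \<omega> \<le> emeasure ?L (random_hull \<omega>)"
      using AE_X_ball AE_space
    proof eventually_elim
      case (elim \<omega>)
      show ?case
      proof (cases "\<omega> \<in> bad")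
        case False
        have "ball_dim d \<rho> \<subseteq> random_hull \<omega>"
        proof (rule ball_subset_random_hull[OF elim(2,1) Kpos])
          fix v assume "v \<in> grid K" "1 - ?e \<le> norm_dim d v"
          then have "\<omega> \<notin> B v" using False by (auto simp: bad_def G_def)
          then show "\<exists>i<n. \<rho> + ?e \<le> inner_dim d v (X i \<omega>)"
            using elim(2) by (auto simp: B_def not_less)
        qed
        then have "emeasure ?L (ball_dim d \<rho>) \<le> emeasure ?L (random_hull \<omega>)"
          using random_hull_sets[OF elim(2)] by (intro emeasure_mono)
        then show ?thesis using False elim(2) by simp
      qed simp
    qed
  qed
  also have "\<dots> = ennreal (\<integral>\<omega>. vol d (random_hull \<omega>) \<partial>M)" by (rule expected_volume_eq[symmetric])
  finally have "\<rho> ^ d * vol d (unit_ball d) * prob (space M - bad) \<le> (\<integral>\<omega>. vol d (random_hull \<omega>) \<partial>M)"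
    by (subst (asm) ennreal_le_iff) (auto intro: integral_nonneg)
  moreover have "\<rho> ^ d * vol d (unit_ball d) * (1 - real (2 * K + 1) ^ d * (1 - q) ^ n)
      \<le> \<rho> ^ d * vol d (unit_ball d) * prob (space M - bad)"
    using pb \<rho> by (intro mult_left_mono) (auto simp: prob_compl)
  ultimately show ?thesis by (simp only: ac_simps)
qed

end

section \<open>Asymptotics\<close>

text \<open>Keeps the shell factors 1 - t ^ d away from 0 uniformly in d when 1 - t is of order 1 /
  d.\<close>

lemma one_minus_power_le_exp:
  assumes "0 \<le> \<eta>" "\<eta> \<le> real d" "d > 0"
  shows "(1 - \<eta> / real d) ^ d \<le> exp (- \<eta>)"
proof -
  have "1 - \<eta> / real d \<le> exp (- \<eta> / real d)"
    using exp_ge_add_one_self[of "- \<eta> / real d"] by simp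
  then have "(1 - \<eta> / real d) ^ d \<le> exp (- \<eta> / real d) ^ d"
    using assms by (intro power_mono) (auto simp: field_simps)
  also have "\<dots> = exp (- \<eta>)" using assms(3) by (simp flip: exp_of_nat_mult)
  finally show ?thesis .
qed

text \<open>
  For \<open>\<beta> < 0\<close> the estimates below use the exponent \<open>d / 2\<close> of the uniform distribution on the ball
  instead of \<open>d / 2 + \<beta>\<close>; the two differ by at most one, which costs only a factor polynomial in \<open>d\<close>.
\<close>

definition cap_exponent :: "nat \<Rightarrow> real \<Rightarrow> real" where
  "cap_exponent d \<beta> = (if \<beta> \<ge> 0 then real d / 2 + \<beta> else real d / 2)"

text \<open>The gap from s to s' pays for the shell: with t = 1 - (s' - s) / d one has 1 - t \<rho>
  \<le> s' / d, and 1 - t ^ d stays above 1 - exp (- (s' - s)). Both signs of \<beta> are brought to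
  the same form.\<close>

lemma beta_cap_upper:
  assumes P: "prob_space (beta_distribution d \<beta>)" and "\<beta> \<ge> -1"
    and s: "0 < s" "s < s'" "s' < real d" and u: "norm_dim d u = 1"
  shows "measure (beta_distribution d \<beta>) (cap d u (1 - s / real d))
    \<le> 1 / (1 - exp (- (s' - s))) * (2 * s' / real d) powr cap_exponent d \<beta>"
proof -
  define \<rho> where "\<rho> = 1 - s / real d"
  define t where "t = 1 - (s' - s) / real d"
  have d: "d > 0" using s by (cases "d = 0") auto
  have \<rho>: "0 < \<rho>" "\<rho> < 1" using s d by (auto simp: \<rho>_def)
  have t: "0 < t" "t < 1" using s d by (auto simp: t_def)
  have e: "0 < 1 - exp (- (s' - s))" "1 - exp (- (s' - s)) \<le> 1" using s by auto
  have sq: "1 - a\<^sup>2 \<le> 2 * (1 - a)" for a :: real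
    using zero_le_power2[of "1 - a"] by (simp add: power2_eq_square algebra_simps)
  show ?thesis
  proof (cases "\<beta> \<ge> 0")
    case True
    have "1 - \<rho>\<^sup>2 \<le> 2 * (s / real d)" using sq[of \<rho>] by (simp add: \<rho>_def)
    also have "\<dots> \<le> 2 * s' / real d" using s d by (simp add: divide_right_mono)
    finally have "1 - \<rho>\<^sup>2 \<le> 2 * s' / real d" .
    moreover have "\<rho>\<^sup>2 \<le> 1" using \<rho> by (simp add: power_le_one)
    ultimately have "(1 - \<rho>\<^sup>2) powr (real d / 2 + \<beta>) \<le> (2 * s' / real d) powr (real d / 2 + \<beta>)"
      using True by (intro powr_mono2) auto
    moreover have "measure (beta_distribution d \<beta>) (cap d u \<rho>) \<le> (1 - \<rho>\<^sup>2) powr (real d / 2 + \<beta>)"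
      using \<rho> True u by (intro beta_cap_upper_nonneg P) auto
    moreover have "1 * (2 * s' / real d) powr (real d / 2 + \<beta>)
        \<le> 1 / (1 - exp (- (s' - s))) * (2 * s' / real d) powr (real d / 2 + \<beta>)"
      using e by (intro mult_right_mono) (auto simp: pos_le_divide_eq)
    ultimately show ?thesis using True by (simp add: cap_exponent_def \<rho>_def)
  next
    case False
    have "1 - t * \<rho> = s' / real d - (s / real d) * ((s' - s) / real d)"
      by (simp add: t_def \<rho>_def algebra_simps diff_divide_distrib)
    moreover have "0 \<le> (s / real d) * ((s' - s) / real d)" using s by simp
    ultimately have "1 - (t * \<rho>)\<^sup>2 \<le> 2 * s' / real d" using sq[of "t * \<rho>"] by simp
    moreover have "(t * \<rho>)\<^sup>2 \<le> 1" using t \<rho> by (simp add: power_le_one mult_le_one)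
    ultimately have le: "(1 - (t * \<rho>)\<^sup>2) powr (real d / 2) \<le> (2 * s' / real d) powr (real d / 2)"
      by (intro powr_mono2) auto
    have "t ^ d \<le> exp (- (s' - s))"
      unfolding t_def using s d by (intro one_minus_power_le_exp) auto
    then have td: "1 - exp (- (s' - s)) \<le> 1 - t ^ d" by simp
    have "measure (beta_distribution d \<beta>) (cap d u \<rho>) \<le> (1 - (t * \<rho>)\<^sup>2) powr (real d / 2) / (1 - t ^ d)"
      using assms False \<rho> t d by (intro beta_cap_upper_neg) auto
    also have "\<dots> \<le> (2 * s' / real d) powr (real d / 2) / (1 - exp (- (s' - s)))"
      using le td e by (intro frac_le) auto
    finally show ?thesis using False by (simp add: cap_exponent_def \<rho>_def)
  qed
qed

lemma beta_cap_lower: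
  assumes P: "prob_space (beta_distribution d \<beta>)" and "\<beta> \<ge> -1"
    and s: "0 < s" "s < s'" "s' < s''" "s'' < real d" and \<delta>: "0 < \<delta>" "\<delta> < 1"
    and ss: "s \<le> (1 - \<delta>) * (1 - s' / (2 * real d)) * s'" and u: "norm_dim d u = 1"
  shows "(1 - exp (- (s'' - s'))) * ((2 * s / real d) powr cap_exponent d \<beta> * (s * \<delta> / (4 * real d)))
    \<le> measure (beta_distribution d \<beta>) (cap d u (1 - s'' / real d))"
proof -
  interpret prob_space "beta_distribution d \<beta>" by fact
  define r where "r = 1 - s' / real d"
  define t where "t = (1 - s'' / real d) / r"
  have d: "d > 0" using s by (cases "d = 0") auto
  have r: "0 < r" "r < 1" using s d by (auto simp: r_def)
  have tr: "t * r = 1 - s'' / real d" using r by (simp add: t_def)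
  have t: "0 < t" "t < 1" using s d r by (auto simp: t_def r_def divide_strict_right_mono)
  have \<kappa>eq: "1 - r\<^sup>2 = (2 / real d) * ((1 - s' / (2 * real d)) * s')"
    using d by (simp add: r_def power2_eq_square field_simps)
  have "s \<le> (1 - \<delta>) * ((1 - s' / (2 * real d)) * s')" using ss by (simp add: mult.assoc)
  then have "(2 / real d) * s \<le> (2 / real d) * ((1 - \<delta>) * ((1 - s' / (2 * real d)) * s'))"
    by (intro mult_left_mono) auto
  then have \<kappa>: "2 * s / real d \<le> (1 - r\<^sup>2) * (1 - \<delta>)"
    unfolding \<kappa>eq by (simp add: ac_simps)
  have pos: "0 < 2 * s / real d" using s d by simp
  have "0 \<le> 1 - r\<^sup>2" using r by (simp add: power_le_one)
  then have "(1 - r\<^sup>2) * (1 - \<delta>) \<le> 1 - r\<^sup>2" using \<delta> by (simp add: mult_left_le)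
  then have \<kappa>2: "2 * s / real d \<le> 1 - r\<^sup>2" using \<kappa> by linarith
  have f: "s * \<delta> / (4 * real d) \<le> (1 - r\<^sup>2) * \<delta> / 8"
    using mult_right_mono[OF \<kappa>2, of "\<delta> / 8"] \<delta> by simp
  have K: "(2 * s / real d) powr e * (s * \<delta> / (4 * real d))
      \<le> ((1 - r\<^sup>2) * (1 - \<delta>)) powr e * ((1 - r\<^sup>2) * \<delta> / 8)" if "e \<ge> 0" for e
    using f \<kappa> pos that s \<delta> by (intro mult_mono powr_mono2) auto
  have t_le: "t \<le> 1 - (s'' - s') / real d"
  proof -
    have "1 - s'' / real d \<le> (1 - (s'' - s') / real d) * r"
    proof -
      have "(1 - (s'' - s') / real d) * r = 1 - s'' / real d + ((s'' - s') / real d) * (s' / real d)"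
        by (simp add: r_def algebra_simps diff_divide_distrib)
      moreover have "0 \<le> ((s'' - s') / real d) * (s' / real d)" using s by simp
      ultimately show ?thesis by linarith
    qed
    then show ?thesis using r by (simp add: t_def pos_divide_le_eq)
  qed
  have c: "1 - exp (- (s'' - s')) \<le> 1 - t ^ d" "0 \<le> 1 - exp (- (s'' - s'))" "1 - exp (- (s'' - s')) \<le> 1"
  proof -
    have "t ^ d \<le> (1 - (s'' - s') / real d) ^ d" using t t_le by (intro power_mono) auto
    also have "\<dots> \<le> exp (- (s'' - s'))" using s d by (intro one_minus_power_le_exp) auto
    finally show "1 - exp (- (s'' - s')) \<le> 1 - t ^ d" by simp
  qed (use s in auto)
  let ?K = "\<lambda>e. (2 * s / real d) powr e * (s * \<delta> / (4 * real d))"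
  have K0: "0 \<le> ?K e" for e using s \<delta> by simp
  show ?thesis
  proof (cases "\<beta> \<ge> 0")
    case True
    have "(1 - exp (- (s'' - s'))) * ?K (real d / 2 + \<beta>) \<le> 1 * ?K (real d / 2 + \<beta>)"
      using c K0 by (intro mult_right_mono) auto
    also have "1 * ?K (real d / 2 + \<beta>) \<le> ((1 - r\<^sup>2) * (1 - \<delta>)) powr (real d / 2 + \<beta>) * ((1 - r\<^sup>2) * \<delta> / 8)"
      using K[of "real d / 2 + \<beta>"] True by simp
    also have "\<dots> \<le> prob (cap d u r)"
      using True r \<delta> u by (intro beta_cap_lower_nonneg P) auto
    also have "\<dots> \<le> prob (cap d u (1 - s'' / real d))"
    proof (rule finite_measure_mono)
      have "1 - s'' / real d \<le> r" using s d by (simp add: r_def divide_right_mono)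
      then show "cap d u r \<subseteq> cap d u (1 - s'' / real d)" by (auto simp: cap_def)
    qed simp
    finally show ?thesis using True by (simp add: cap_exponent_def)
  next
    case False
    have "(1 - exp (- (s'' - s'))) * ?K (real d / 2) \<le> (1 - t ^ d) * ?K (real d / 2)"
      using c K0 by (intro mult_right_mono) auto
    also have "\<dots> \<le> (1 - t ^ d) * (((1 - r\<^sup>2) * (1 - \<delta>)) powr (real d / 2) * ((1 - r\<^sup>2) * \<delta> / 8))"
      using order_trans[OF c(2,1)] K[of "real d / 2"] by (intro mult_left_mono) auto
    also have "\<dots> \<le> prob (cap d u (t * r))"
      using assms False r t d by (intro beta_cap_lower_neg) auto
    finally show ?thesis using False by (simp add: cap_exponent_def tr)
  qed
qed

text \<open>Here b is the base of n and a that of the cap bound. As b \<ge> 1, its exponent may be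
  raised to \<open>cap_exponent\<close>; d / 2 - 1 bounds \<open>cap_exponent\<close> from below for
  every admissible \<beta>.\<close>

lemma sample_size_upper:
  assumes "\<beta> \<ge> -1" "1 \<le> b" "0 < a" "a * b \<le> \<theta>" "\<theta> \<le> 1" "d \<ge> 2"
  shows "b powr (real d / 2 + \<beta>) * a powr cap_exponent d \<beta> \<le> \<theta> powr (real d / 2 - 1)"
proof -
  have ab: "0 < a * b" using assms by simp
  have e: "real d / 2 + \<beta> \<le> cap_exponent d \<beta>" "real d / 2 - 1 \<le> cap_exponent d \<beta>" "0 \<le> cap_exponent d \<beta>"
    using assms by (auto simp: cap_exponent_def)
  have "b powr (real d / 2 + \<beta>) * a powr cap_exponent d \<beta> \<le> b powr cap_exponent d \<beta> * a powr cap_exponent d \<beta>"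
    using assms e by (intro mult_right_mono powr_mono) auto
  also have "\<dots> = (a * b) powr cap_exponent d \<beta>"
    using assms by (simp add: powr_mult mult.commute)
  also have "\<dots> \<le> \<theta> powr cap_exponent d \<beta>" using assms e ab by (intro powr_mono2) auto
  also have "\<dots> \<le> \<theta> powr (real d / 2 - 1)" using assms(4,5) e ab by (intro powr_mono') auto
  finally show ?thesis .
qed

text \<open>Now \<open>cap_exponent\<close> may exceed the exponent of n by up to one, whence the
  division by b, which is only linear in d in the application.\<close>

lemma sample_size_lower:
  assumes "\<beta> \<ge> -1" "1 \<le> b" "0 < a" "\<theta> \<le> a * b" "1 \<le> \<theta>" "d \<ge> 2"
  shows "\<theta> powr (real d / 2 - 1) / b \<le> b powr (real d / 2 + \<beta>) * a powr cap_exponent d \<beta>"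
proof -
  have e: "cap_exponent d \<beta> - 1 \<le> real d / 2 + \<beta>" "real d / 2 - 1 \<le> cap_exponent d \<beta>" "0 \<le> cap_exponent d \<beta>"
    using assms by (auto simp: cap_exponent_def)
  have "\<theta> powr (real d / 2 - 1) \<le> \<theta> powr cap_exponent d \<beta>" using assms e by (intro powr_mono) auto
  also have "\<dots> \<le> (a * b) powr cap_exponent d \<beta>" using assms e by (intro powr_mono2) auto
  also have "\<dots> = b powr cap_exponent d \<beta> * a powr cap_exponent d \<beta>"
    using assms by (simp add: powr_mult mult.commute)
  finally have "\<theta> powr (real d / 2 - 1) / b \<le> b powr cap_exponent d \<beta> * a powr cap_exponent d \<beta> / b"
    using assms by (intro divide_right_mono) auto
  also have "\<dots> = b powr (cap_exponent d \<beta> - 1) * a powr cap_exponent d \<beta>"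
    using assms by (simp add: powr_diff)
  also have "\<dots> \<le> b powr (real d / 2 + \<beta>) * a powr cap_exponent d \<beta>"
    using assms e by (intro mult_right_mono powr_mono) auto
  finally show ?thesis .
qed

text \<open>The cubic term dominates the logarithm of the number of directions, the other one is a
  lower bound for n q; the exponential growth of the latter wins.\<close>

lemma grid_error_tendsto_0:
  fixes \<theta> c A :: real
  assumes "\<theta> > 1" "c > 0"
  shows "(\<lambda>d. exp (A * real d ^ 3 - c * \<theta> powr (real d / 2 - 1) / (real d)\<^sup>2)) \<longlonglongrightarrow> 0"
proof -
  define L where "L = ln \<theta>"
  have L: "L > 0" using assms by (simp add: L_def)
  have eq: "\<theta> powr (real d / 2 - 1) = exp ((real d / 2 - 1) * L)" for d
    using assms by (simp add: powr_def L_def)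
  show ?thesis unfolding eq using L assms(2) by real_asymp
qed

lemma exp_limit: "(\<lambda>d. (1 - s / real d) ^ d) \<longlonglongrightarrow> exp (- s)"
  using tendsto_exp_limit_sequentially[of "- s"] by simp

lemma one_minus_power_le_exp_mult:
  assumes "q \<le> 1"
  shows "(1 - q) ^ n \<le> exp (- (real n * q))"
proof -
  have "(1 - q) ^ n \<le> exp (- q) ^ n"
    using assms exp_ge_add_one_self[of "- q"] by (intro power_mono) auto
  then show ?thesis by (simp flip: exp_of_nat_mult)
qed


theorem theorem3p1:
  fixes x :: real
    and \<beta> \<epsilon> :: "nat \<Rightarrow> real"
    and n :: "nat \<Rightarrow> nat"
    and M :: "nat \<Rightarrow> 'a measure"
    and X :: "nat \<Rightarrow> nat \<Rightarrow> 'a \<Rightarrow> (nat \<Rightarrow> real)"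
  assumes "x > 0"
    and "\<And>d. d \<ge> 2 \<Longrightarrow> \<beta> d \<ge> -1"
    and "\<epsilon> \<longlonglongrightarrow> 0"
    and "\<forall>\<^sub>F d in sequentially.
           real (n d) = (real d / (2 * x + \<epsilon> d)) powr (real d / 2 + \<beta> d)"
    and "\<And>d. d \<ge> 2 \<Longrightarrow> prob_space (M d)"
    and "\<And>d. d \<ge> 2 \<Longrightarrow>
           prob_space.indep_vars (M d) (\<lambda>_. lborel_dim d) (X d) {..<n d}"
    and "\<And>d i. d \<ge> 2 \<Longrightarrow> i < n d \<Longrightarrow>
           distr (M d) (lborel_dim d) (X d i) = beta_distribution d (\<beta> d)"
  shows "(\<lambda>d. (\<integral>\<omega>. vol d (convex_dim d hull ((\<lambda>i. X d i \<omega>) ` {..<n d})) \<partial>M d)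
               / vol d (unit_ball d)) \<longlonglongrightarrow> exp (- x)"
proof -
  define b where "b d = real d / (2 * x + \<epsilon> d)" for d
  define E where "E d = (\<integral>\<omega>. vol d (convex_dim d hull ((\<lambda>i. X d i \<omega>) ` {..<n d})) \<partial>M d)
               / vol d (unit_ball d)" for d
  have lim2x: "(\<lambda>d. 2 * x + \<epsilon> d) \<longlonglongrightarrow> 2 * x"
    using tendsto_add[OF tendsto_const[of "2 * x"] assms(3)] by simp
  have ev_gt: "\<forall>\<^sub>F d in sequentially. 2 * s < 2 * x + \<epsilon> d" if "s < x" for s
    using that by (intro order_tendstoD(1)[OF lim2x]) auto
  have ev_lt: "\<forall>\<^sub>F d in sequentially. 2 * x + \<epsilon> d < 2 * s" if "s > x" for s
    using that by (intro order_tendstoD(2)[OF lim2x]) auto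
  have ev_large: "\<forall>\<^sub>F d in sequentially. C < real d" for C :: real
    using filterlim_real_sequentially by (simp add: filterlim_at_top_dense)
  \<comment> \<open>The bound b \<ge> 1 is for comparing exponents, the linear bound for the one
    factor b lost in the lower estimate.\<close>
  have ev_b: "\<forall>\<^sub>F d in sequentially. 1 \<le> b d \<and> b d \<le> real d / x"
  proof -
    have "\<forall>\<^sub>F d in sequentially. 2 * (x / 2) < 2 * x + \<epsilon> d" using assms(1) by (intro ev_gt) simp
    moreover have "\<forall>\<^sub>F d in sequentially. 2 * x + \<epsilon> d < 2 * (2 * x)" using assms(1) by (intro ev_lt) simp
    ultimately show ?thesis using ev_large[of "4 * x"]
    proof eventually_elim
      case (elim d)
      then have "1 \<le> b d" using assms(1) by (simp add: b_def le_divide_eq)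
      moreover have "b d \<le> real d / x"
        unfolding b_def using elim assms(1) by (intro divide_left_mono) auto
      ultimately show ?case by simp
    qed
  qed
  have ev_points: "\<forall>\<^sub>F d in sequentially. d \<ge> 2 \<and> real (n d) = b d powr (real d / 2 + \<beta> d) \<and>
      random_points (M d) d (n d) (X d) (beta_distribution d (\<beta> d))"
    using assms(4) ev_b eventually_ge_at_top[of 2]
  proof eventually_elim
    case (elim d)
    have nb: "real (n d) = b d powr (real d / 2 + \<beta> d)" using elim by (simp add: b_def)
    then have n0: "n d > 0" using elim(2) by (cases "n d = 0") auto
    interpret prob_space "M d" using assms(5) elim(3) .
    have "X d 0 \<in> M d \<rightarrow>\<^sub>M lborel_dim d" using assms(6)[OF elim(3)] n0 by (simp add: indep_vars_def)
    \<comment> \<open>The law of a sample point is a probability measure; this is where a nonempty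
      sample enters.\<close>
    then have P: "prob_space (beta_distribution d (\<beta> d))"
      using prob_space_distr[of "X d 0" "lborel_dim d"] assms(7)[OF elim(3) n0] by simp
    have "random_points (M d) d (n d) (X d) (beta_distribution d (\<beta> d))"
      using elim(3) n0 assms(6,7)[OF elim(3)] AE_beta_unit_ball[OF P assms(2)[OF elim(3)]]
      by unfold_locales auto
    then show ?case using nb elim(3) by simp
  qed
  have upper: "\<forall>\<^sub>F d in sequentially. E d < a" if a: "exp (- x) < a" for a
  proof -
    have "((\<lambda>s. exp (- s)) \<longlongrightarrow> exp (- x)) (at_left x)"
      by (intro tendsto_intros)
    then have "\<forall>\<^sub>F s in at_left x. exp (- s) < a" using a by (rule order_tendstoD)
    moreover have "\<forall>\<^sub>F s in at_left x. 0 < s \<and> s < x"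
      using eventually_at_left_real[OF assms(1)] by eventually_elim auto
    ultimately have "\<forall>\<^sub>F s in at_left x. exp (- s) < a \<and> 0 < s \<and> s < x" by eventually_elim auto
    then obtain s where s: "exp (- s) < a" "0 < s" "s < x"
      using eventually_happens'[OF trivial_limit_at_left_real] by blast
    \<comment> \<open>The gap from s to s' is spent on the cap bound; the gap from s' to s'' makes
      \<theta> < 1, and the gap from s'' to x absorbs the perturbation \<epsilon>.\<close>
    define s' where "s' = (s + x) / 2"
    define s'' where "s'' = (s' + x) / 2"
    have ss: "s < s'" "s' < s''" "s'' < x" using s by (auto simp: s'_def s''_def)
    define \<theta> where "\<theta> = s' / s''"
    have \<theta>: "0 < \<theta>" "\<theta> < 1" using s ss by (auto simp: \<theta>_def)
    define C where "C = 1 / (1 - exp (- (s' - s)))"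
    have C: "0 < C" using ss by (simp add: C_def)
    have bound: "\<forall>\<^sub>F d in sequentially. E d \<le> (1 - s / real d) ^ d + C * \<theta> powr (real d / 2 - 1)"
      using ev_points ev_b ev_gt[OF ss(3)] ev_large[of s']
    proof eventually_elim
      case (elim d)
      interpret random_points "M d" d "n d" "X d" "beta_distribution d (\<beta> d)" using elim(1) by blast
      define q where "q = C * (2 * s' / real d) powr cap_exponent d (\<beta> d)"
      have d: "d \<ge> 2" using elim(1) by blast
      have "(2 * s' / real d) * b d \<le> \<theta>"
      proof -
        have "(2 * s' / real d) * b d = 2 * s' / (2 * x + \<epsilon> d)" using d by (simp add: b_def)
        also have "\<dots> \<le> 2 * s' / (2 * s'')" using elim(3) s ss by (intro divide_left_mono) auto
        finally show ?thesis by (simp add: \<theta>_def)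
      qed
      then have "real (n d) * (2 * s' / real d) powr cap_exponent d (\<beta> d) \<le> \<theta> powr (real d / 2 - 1)"
        using sample_size_upper[of "\<beta> d" "b d" "2 * s' / real d" \<theta> d] elim(1,2) assms(2)[OF d] s ss \<theta> d
        by simp
      then have nq: "real (n d) * q \<le> C * \<theta> powr (real d / 2 - 1)"
        using C by (simp add: q_def mult.left_commute)
      have "(\<integral>\<omega>. vol d (random_hull \<omega>) \<partial>M d) \<le> ((1 - s / real d) ^ d + real (n d) * q) * vol d (unit_ball d)"
      proof (rule expected_volume_upper)
        show "0 < 1 - s / real d" "1 - s / real d < 1" using elim(4) s ss d by (auto simp: divide_less_eq)
        show "0 \<le> q" using C by (simp add: q_def)
        fix u assume "norm_dim d u = 1"
        then show "measure (beta_distribution d (\<beta> d)) (cap d u (1 - s / real d)) \<le> q"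
          unfolding q_def C_def using elim(4) s ss assms(2)[OF d]
          by (intro beta_cap_upper prob_space_\<mu>) auto
      qed
      then have "E d \<le> (1 - s / real d) ^ d + real (n d) * q"
        unfolding E_def random_hull_def using vol_unit_ball_pos[of d] by (simp add: pos_divide_le_eq)
      then show ?case using nq by linarith
    qed
    have "(\<lambda>d. \<theta> powr (real d / 2 - 1)) \<longlonglongrightarrow> 0"
    proof -
      define L where "L = ln \<theta>"
      have L: "L < 0" using \<theta> by (simp add: L_def)
      have eq: "\<theta> powr (real d / 2 - 1) = exp ((real d / 2 - 1) * L)" for d
        using \<theta> by (simp add: powr_def L_def)
      show ?thesis unfolding eq using L by real_asymp
    qed
    then have "(\<lambda>d. (1 - s / real d) ^ d + C * \<theta> powr (real d / 2 - 1)) \<longlonglongrightarrow> exp (- s) + C * 0"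
      by (intro tendsto_intros exp_limit)
    then have "\<forall>\<^sub>F d in sequentially. (1 - s / real d) ^ d + C * \<theta> powr (real d / 2 - 1) < a"
      using s(1) by (intro order_tendstoD(2)) auto
    with bound show ?thesis by eventually_elim linarith
  qed
  have lower: "\<forall>\<^sub>F d in sequentially. a < E d" if a: "a < exp (- x)" for a
  proof -
    have "((\<lambda>s. exp (- s)) \<longlongrightarrow> exp (- x)) (at_right x)"
      by (intro tendsto_intros)
    then have "\<forall>\<^sub>F s in at_right x. a < exp (- s)" using a by (rule order_tendstoD)
    moreover have "\<forall>\<^sub>F s in at_right x. x < s" by (rule eventually_at_right_less)
    ultimately have "\<forall>\<^sub>F s in at_right x. a < exp (- s) \<and> x < s" by eventually_elim auto
    then obtain s where s: "a < exp (- s)" "x < s"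
      using eventually_happens'[OF trivial_limit_at_right_real] by blast
    \<comment> \<open>Five equal gaps from x to s: up to s0 for \<epsilon> and \<theta>, up to s1
      for \<delta>, up to s2 for the shell, and two for the two grid errors.\<close>
    define \<eta> where "\<eta> = (s - x) / 5"
    have \<eta>: "\<eta> > 0" using s by (simp add: \<eta>_def)
    define s0 where "s0 = x + \<eta>"
    define s1 where "s1 = x + 2 * \<eta>"
    define s2 where "s2 = x + 3 * \<eta>"
    have s_eq: "s = s2 + 2 * \<eta>" by (simp add: s2_def \<eta>_def field_simps)
    have ss: "0 < s0" "x < s0" "s0 < s1" "s1 < s2" "s2 < s"
      using \<eta> assms(1) s_eq by (auto simp: s0_def s1_def s2_def)
    have mid: "x < (s0 + x) / 2" using ss by simp
    \<comment> \<open>Chosen so that (1 - \<delta>) s1 = s1 - \<eta> / 2 still exceeds s0.\<close>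
    define \<delta> where "\<delta> = \<eta> / (2 * s1)"
    have \<delta>: "0 < \<delta>" "\<delta> < 1" using \<eta> ss assms(1) by (auto simp: \<delta>_def s1_def)
    \<comment> \<open>The ratio of s0 to the midpoint of s0 and x; eventually x + \<epsilon> / 2
      lies below that midpoint.\<close>
    define \<theta> where "\<theta> = 2 * s0 / (s0 + x)"
    have \<theta>: "1 < \<theta>" using ss assms(1) by (simp add: \<theta>_def)
    define c where "c = (1 - exp (- (s2 - s1))) * (s0 * \<delta> / 4) * x"
    have c: "c > 0" using ss \<delta> assms(1) by (simp add: c_def)
    define A where "A = 2 * (1 / \<eta> + 2)"
    have ev_\<delta>: "\<forall>\<^sub>F d in sequentially. s0 < (1 - \<delta>) * (1 - s1 / (2 * real d)) * s1"
    proof (rule order_tendstoD(1))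
      show "(\<lambda>d. (1 - \<delta>) * (1 - s1 / (2 * real d)) * s1) \<longlonglongrightarrow> (1 - \<delta>) * (1 - 0) * s1"
        by (intro tendsto_intros) real_asymp
      show "s0 < (1 - \<delta>) * (1 - 0) * s1"
        using ss \<eta> by (simp add: \<delta>_def algebra_simps) (simp add: s0_def s1_def)
    qed
    have bound: "\<forall>\<^sub>F d in sequentially.
        (1 - s / real d) ^ d * (1 - exp (A * real d ^ 3 - c * \<theta> powr (real d / 2 - 1) / (real d)\<^sup>2)) \<le> E d"
      using ev_points ev_b ev_lt[OF mid] ev_gt[OF assms(1)] ev_large[of s] ev_large[of \<eta>] ev_\<delta>
    proof eventually_elim
      case (elim d)
      interpret random_points "M d" d "n d" "X d" "beta_distribution d (\<beta> d)" using elim(1) by blast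
      interpret \<mu>: prob_space "beta_distribution d (\<beta> d)" by (rule prob_space_\<mu>)
      have d: "d \<ge> 2" "real d > 0" using elim(1) by auto
      \<comment> \<open>This mesh gives d / K \<le> \<eta> / d, the scale 1 / d on which the radii
        differ.\<close>
      define K where "K = nat \<lceil>(real d)\<^sup>2 / \<eta>\<rceil>"
      have K: "(real d)\<^sup>2 / \<eta> \<le> real K" "real K \<le> (real d)\<^sup>2 / \<eta> + 1"
        using \<eta> by (auto simp: K_def)
      have "real d < (real d)\<^sup>2 / \<eta>"
        using elim(6) \<eta> d by (simp add: less_divide_eq power2_eq_square)
      then have dK: "real d < real K" using K(1) by linarith
      have e: "real d / real K \<le> \<eta> / real d"
        using K(1) \<eta> d dK by (simp add: field_simps power2_eq_square)
      define q where "q = (1 - exp (- (s2 - s1))) *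
          ((2 * s0 / real d) powr cap_exponent d (\<beta> d) * (s0 * \<delta> / (4 * real d)))"
      have cap: "q \<le> \<mu>.prob (cap d u (1 - s2 / real d))" if "norm_dim d u = 1" for u
        unfolding q_def using ss \<delta> elim(5,7) assms(2)[OF d(1)] that
        by (intro beta_cap_lower prob_space_\<mu>) auto
      have q1: "q \<le> 1"
      proof -
        \<comment> \<open>Any unit vector bounds q by a probability; one exists because d >
          0.\<close>
        have "norm_dim d (\<lambda>i. if i = 0 then 1 else 0) = 1"
          using d(1) by (simp add: L2_set_def if_distrib[of "\<lambda>z. z\<^sup>2"] cong: if_cong)
        from cap[OF this] show ?thesis using \<mu>.prob_le_1 order_trans by blast
      qed
      have "(1 - s / real d) ^ d * (1 - real (2 * K + 1) ^ d * (1 - q) ^ n d) * vol d (unit_ball d)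
        \<le> (\<integral>\<omega>. vol d (random_hull \<omega>) \<partial>M d)"
      proof (rule expected_volume_lower[OF _ _ cap q1 dK])
        show "0 < 1 - s / real d" "0 \<le> 1 - s2 / real d"
          using elim(5) ss d by (auto simp: divide_less_eq divide_le_eq)
        \<comment> \<open>The gap 2 \<eta> / d between the two radii covers d / K twice: once added
          to the height, once lost to the length of the grid vector.\<close>
        have "(1 - s2 / real d) * (real d / real K) \<le> 1 * (real d / real K)"
          using ss by (intro mult_right_mono) auto
        moreover have "1 - s / real d + 2 * (\<eta> / real d) = 1 - s2 / real d"
          by (simp add: s_eq diff_divide_distrib add_divide_distrib)
        ultimately show "1 - s / real d + real d / real K \<le> (1 - s2 / real d) * (1 - real d / real K)"
          using e by (simp add: right_diff_distrib)
      qed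
      then have E: "(1 - s / real d) ^ d * (1 - real (2 * K + 1) ^ d * (1 - q) ^ n d) \<le> E d"
        unfolding E_def random_hull_def using vol_unit_ball_pos[of d] by (simp add: pos_le_divide_eq)
      have "\<theta> \<le> (2 * s0 / real d) * b d"
      proof -
        have "\<theta> \<le> 2 * s0 / (2 * x + \<epsilon> d)"
          unfolding \<theta>_def using elim(3,4) ss assms(1) by (intro divide_left_mono) auto
        also have "\<dots> = (2 * s0 / real d) * b d" using d by (simp add: b_def)
        finally show ?thesis .
      qed
      then have "\<theta> powr (real d / 2 - 1) / b d
          \<le> real (n d) * (2 * s0 / real d) powr cap_exponent d (\<beta> d)"
        using sample_size_lower[of "\<beta> d" "b d" "2 * s0 / real d" \<theta> d] elim(1,2) assms(2)[OF d(1)] ss \<theta> d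
        by simp
      moreover have "\<theta> powr (real d / 2 - 1) * x / real d \<le> \<theta> powr (real d / 2 - 1) / b d"
      proof -
        have "\<theta> powr (real d / 2 - 1) / (real d / x) \<le> \<theta> powr (real d / 2 - 1) / b d"
          using elim(2) d assms(1) by (intro divide_left_mono) auto
        then show ?thesis by simp
      qed
      ultimately have "\<theta> powr (real d / 2 - 1) * x / real d
          \<le> real (n d) * (2 * s0 / real d) powr cap_exponent d (\<beta> d)" by linarith
      then have "(1 - exp (- (s2 - s1))) * (s0 * \<delta> / (4 * real d)) * (\<theta> powr (real d / 2 - 1) * x / real d)
          \<le> (1 - exp (- (s2 - s1))) * (s0 * \<delta> / (4 * real d))
            * (real (n d) * (2 * s0 / real d) powr cap_exponent d (\<beta> d))"
        using ss \<delta> by (intro mult_left_mono) auto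
      also have "\<dots> = real (n d) * q" by (simp add: q_def)
      also have "(1 - exp (- (s2 - s1))) * (s0 * \<delta> / (4 * real d)) * (\<theta> powr (real d / 2 - 1) * x / real d)
          = c * \<theta> powr (real d / 2 - 1) / (real d)\<^sup>2"
        by (simp add: c_def power2_eq_square ac_simps)
      finally have nq: "c * \<theta> powr (real d / 2 - 1) / (real d)\<^sup>2 \<le> real (n d) * q" .
      have "real (2 * K + 1) ^ d \<le> exp (A * real d ^ 3)"
      proof -
        have "real (2 * K + 1) ^ d \<le> exp (2 * real K) ^ d"
          using exp_ge_add_one_self[of "2 * real K"] by (intro power_mono) auto
        also have "\<dots> = exp (2 * real d * real K)" by (simp add: ac_simps flip: exp_of_nat_mult)
        also have "\<dots> \<le> exp (A * real d ^ 3)"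
        proof -
          have "2 * real d * real K \<le> 2 * real d * ((real d)\<^sup>2 / \<eta> + 1)"
            using K(2) by (intro mult_left_mono) auto
          moreover have "2 * real d * ((real d)\<^sup>2 / \<eta> + 1) = 2 * (1 / \<eta>) * real d ^ 3 + 2 * real d"
            by (simp add: power2_eq_square power3_eq_cube algebra_simps)
          moreover have "2 * real d \<le> 4 * real d ^ 3"
          proof -
            have "real d ^ 1 \<le> real d ^ 3" using d by (intro power_increasing) auto
            moreover have "0 \<le> real d ^ 3" by simp
            ultimately show ?thesis unfolding power_one_right by linarith
          qed
          moreover have "A * real d ^ 3 = 2 * (1 / \<eta>) * real d ^ 3 + 4 * real d ^ 3"
            by (simp add: A_def algebra_simps)
          ultimately have "2 * real d * real K \<le> A * real d ^ 3" by linarith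
          then show ?thesis by simp
        qed
        finally show ?thesis .
      qed
      moreover have "(1 - q) ^ n d \<le> exp (- (c * \<theta> powr (real d / 2 - 1) / (real d)\<^sup>2))"
        by (rule order_trans[OF one_minus_power_le_exp_mult[OF q1]]) (use nq in simp)
      ultimately have "real (2 * K + 1) ^ d * (1 - q) ^ n d
          \<le> exp (A * real d ^ 3) * exp (- (c * \<theta> powr (real d / 2 - 1) / (real d)\<^sup>2))"
        using q1 by (intro mult_mono) auto
      also have "\<dots> = exp (A * real d ^ 3 - c * \<theta> powr (real d / 2 - 1) / (real d)\<^sup>2)"
        by (simp only: exp_add[symmetric] diff_conv_add_uminus)
      finally have "(1 - s / real d) ^ d * (1 - exp (A * real d ^ 3 - c * \<theta> powr (real d / 2 - 1) / (real d)\<^sup>2))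
          \<le> (1 - s / real d) ^ d * (1 - real (2 * K + 1) ^ d * (1 - q) ^ n d)"
        using elim(5) ss d by (intro mult_left_mono) (auto simp: divide_le_eq)
      with E show ?case by linarith
    qed
    have "(\<lambda>d. (1 - s / real d) ^ d * (1 - exp (A * real d ^ 3 - c * \<theta> powr (real d / 2 - 1) / (real d)\<^sup>2)))
        \<longlonglongrightarrow> exp (- s) * (1 - 0)"
      by (intro tendsto_intros exp_limit grid_error_tendsto_0 \<theta> c)
    then have "\<forall>\<^sub>F d in sequentially.
        a < (1 - s / real d) ^ d * (1 - exp (A * real d ^ 3 - c * \<theta> powr (real d / 2 - 1) / (real d)\<^sup>2))"
      using s(1) by (intro order_tendstoD(1)) auto
    with bound show ?thesis by eventually_elim linarith
  qed
  have "E \<longlonglongrightarrow> exp (- x)" by (rule order_tendstoI) (use lower upper in auto)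
  then show ?thesis by (simp add: E_def[abs_def])
qed

end
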